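(* Let $X$ be a set, $K:X\times X\to\mathbb{C}$ a positive definite kernel with reproducing kernel Hilbert space $\mathcal{H}(K)$, $\mathscr{B}$ a sigma-algebra of subsets of $X$, and $\mu$ a sigma-finite positive measure on $(X,\mathscr{B})$. Assume that the operator $T$ given by $$\mathcal{H}(K)\ni f\xrightarrow{\;T\;}(f(x))_{x\in X}\in L^{2}(\mu)$$ is densely defined and closable, and let $T^{*}:L^{2}(\mu)\to\mathcal{H}(K)$ be the corresponding adjoint operator. Fix $\beta>0$ and $\psi\in L^{2}(\mu)$, and set $$Q_{\psi,\beta}(f)=\|\psi-Tf\|_{L^{2}(\mu)}^{2}+\beta\|f\|_{\mathcal{H}(K)}^{2},$$ defined for $f\in\mathcal{H}(K)$, or in the dense subspace $\mathrm{dom}(T)$. Then the optimization problem $$\inf_{f\in\mathcal{H}(K)}Q_{\psi,\beta}(f)$$ has a unique solution $F$ in $\mathcal{H}(K)$; it is $$F=(\beta I+T^{*}T)^{-1}T^{*}\psi .$$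
   Context: A positive definite kernel on a set $S$ is a function $K:S\times S\to\mathbb{C}$ with $\sum_{i,j=1}^{N}\overline{c_i}c_jK(x_i,x_j)\ge 0$ for all $N\in\mathbb{N}$, $x_1,\dots,x_N\in S$, $c_1,\dots,c_N\in\mathbb{C}$. Inner products are conjugate linear in the first variable. $\mathcal{H}(K)$ is the Hilbert space of functions on $S$ obtained by completing $\mathrm{span}\{K_x:=K(\cdot,x):x\in S\}$ in the inner product $\langle\sum c_iK_{x_i},\sum d_jK_{x_j}\rangle=\sum\overline{c_i}d_jK(x_i,x_j)$; it satisfies $f(x)=\langle K_x,f\rangle_{\mathcal{H}(K)}$ for $f\in\mathcal{H}(K)$, $x\in S$. The adjoint is given by $\langle f,T^{*}\psi\rangle_{\mathcal{H}(K)}=\langle Tf,\psi\rangle_{L^{2}(\mu)}=\int_X\overline{f(s)}\psi(s)\,d\mu(s)$.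
   Formalization: T*ψ need not exist for every ψ in L²(μ) when T is unbounded: the formula for F is literal for ψ in dom(T* ), and otherwise uses the closure of (βI+T*T)^{-1}T*. In Q and T*T, T means its closure, since for non-closed T the minimizer may lie outside dom(T). *)

theory Defs
  imports "HOL-Analysis.Analysis"
begin

section \<open>Reproducing kernel Hilbert spaces\<close>

definition pos_def_kernel :: "'a set \<Rightarrow> ('a \<Rightarrow> 'a \<Rightarrow> complex) \<Rightarrow> bool" where
  "pos_def_kernel S K \<longleftrightarrow>
     (\<forall>(N::nat) (x::nat \<Rightarrow> 'a) (c::nat \<Rightarrow> complex). (\<forall>i<N. x i \<in> S) \<longrightarrow>
        (\<Sum>i<N. \<Sum>j<N. cnj (c i) * c j * K (x i) (x j)) \<in> \<real>\<^sub>\<ge>\<^sub>0)"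

text \<open>
  A finite linear combination of kernel sections \<open>K(\<cdot>,x)\<close>, \<open>x \<in> S\<close>, is given by its finitely
  supported coefficient function. Functions on \<open>S\<close> are total functions that vanish off \<open>S\<close>.
\<close>

definition kernel_coeffs :: "'a set \<Rightarrow> ('a \<Rightarrow> complex) set" where
  "kernel_coeffs S = {c. finite {x. c x \<noteq> 0} \<and> {x. c x \<noteq> 0} \<subseteq> S}"

definition kernel_comb :: "'a set \<Rightarrow> ('a \<Rightarrow> 'a \<Rightarrow> complex) \<Rightarrow> ('a \<Rightarrow> complex) \<Rightarrow> 'a \<Rightarrow> complex" where
  "kernel_comb S K c = (\<lambda>y. if y \<in> S then \<Sum>x | c x \<noteq> 0. c x * K y x else 0)"

definition kernel_form ::
  "('a \<Rightarrow> 'a \<Rightarrow> complex) \<Rightarrow> ('a \<Rightarrow> complex) \<Rightarrow> ('a \<Rightarrow> complex) \<Rightarrow> complex" where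
  "kernel_form K c d = (\<Sum>x | c x \<noteq> 0. \<Sum>y | d y \<noteq> 0. cnj (c x) * d y * K x y)"

text \<open>
  The completion is realised by functions: since \<open>f(x) = \<langle>K\<^sub>x, f\<rangle>\<close>, the element defined by a Cauchy
  sequence of the span is the pointwise limit of that sequence.
\<close>

definition kernel_represents ::
  "'a set \<Rightarrow> ('a \<Rightarrow> 'a \<Rightarrow> complex) \<Rightarrow> (nat \<Rightarrow> 'a \<Rightarrow> complex) \<Rightarrow> ('a \<Rightarrow> complex) \<Rightarrow> bool" where
  "kernel_represents S K u f \<longleftrightarrow>
     (\<forall>n. u n \<in> kernel_coeffs S) \<and>
     (\<forall>e>0. \<exists>N. \<forall>m\<ge>N. \<forall>n\<ge>N.
        Re (kernel_form K (\<lambda>x. u m x - u n x) (\<lambda>x. u m x - u n x)) < e) \<and>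
     (\<forall>y\<in>S. (\<lambda>n. kernel_comb S K (u n) y) \<longlonglongrightarrow> f y) \<and>
     (\<forall>y. y \<notin> S \<longrightarrow> f y = 0)"

definition rkhs :: "'a set \<Rightarrow> ('a \<Rightarrow> 'a \<Rightarrow> complex) \<Rightarrow> ('a \<Rightarrow> complex) set" where
  "rkhs S K = {f. \<exists>u. kernel_represents S K u f}"

definition rkhs_inner ::
  "'a set \<Rightarrow> ('a \<Rightarrow> 'a \<Rightarrow> complex) \<Rightarrow> ('a \<Rightarrow> complex) \<Rightarrow> ('a \<Rightarrow> complex) \<Rightarrow> complex" where
  "rkhs_inner S K f g =
     (THE z. \<forall>u v. kernel_represents S K u f \<longrightarrow> kernel_represents S K v g \<longrightarrow>
        (\<lambda>n. kernel_form K (u n) (v n)) \<longlonglongrightarrow> z)"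

definition rkhs_norm :: "'a set \<Rightarrow> ('a \<Rightarrow> 'a \<Rightarrow> complex) \<Rightarrow> ('a \<Rightarrow> complex) \<Rightarrow> real" where
  "rkhs_norm S K f = sqrt (Re (rkhs_inner S K f f))"

section \<open>Square-integrable functions\<close>

text \<open>
  Elements of the Hilbert space \<open>L\<^sup>2(M)\<close> are handled through their representatives;
  equality in \<open>L\<^sup>2(M)\<close> is equality almost everywhere.
\<close>

definition L2 :: "'a measure \<Rightarrow> ('a \<Rightarrow> complex) set" where
  "L2 M = {g \<in> borel_measurable M. integrable M (\<lambda>x. (cmod (g x))\<^sup>2)}"

definition L2_inner :: "'a measure \<Rightarrow> ('a \<Rightarrow> complex) \<Rightarrow> ('a \<Rightarrow> complex) \<Rightarrow> complex" where
  "L2_inner M g h = (\<integral>x. cnj (g x) * h x \<partial>M)"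

definition L2_norm :: "'a measure \<Rightarrow> ('a \<Rightarrow> complex) \<Rightarrow> real" where
  "L2_norm M g = sqrt (\<integral>x. (cmod (g x))\<^sup>2 \<partial>M)"

section \<open>Unbounded operators, as graphs\<close>

text \<open>
  An operator is the set of its pairs (argument, value), so that \<open>Domain\<close> is its domain,
  \<open>A O B\<close> is ``first \<open>A\<close>, then \<open>B\<close>'' and \<open>A\<inverse>\<close> is the inverse. A value (or argument) in \<open>L\<^sup>2(M)\<close>
  occurs with all its representatives.
\<close>

definition fun_subspace :: "('a \<Rightarrow> complex) set \<Rightarrow> bool" where
  "fun_subspace D \<longleftrightarrow> (\<lambda>_. 0) \<in> D \<and>
     (\<forall>f\<in>D. \<forall>g\<in>D. (\<lambda>x. f x + g x) \<in> D) \<and> (\<forall>c. \<forall>f\<in>D. (\<lambda>x. c * f x) \<in> D)"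

text \<open>
  Evaluation \<open>f \<mapsto> (f(x))\<^sub>x\<close> with domain \<open>D\<close>, a subspace of the square-integrable elements of the RKHS.
  For the largest such \<open>D\<close> this operator is closed, so it then equals its closure.
\<close>

definition eval_op :: "'a measure \<Rightarrow> ('a \<Rightarrow> complex) set \<Rightarrow> (('a \<Rightarrow> complex) \<times> ('a \<Rightarrow> complex)) set" where
  "eval_op M D = {(f, g). f \<in> D \<and> g \<in> L2 M \<and> (AE x in M. g x = f x)}"

definition rkhs_dense :: "'a set \<Rightarrow> ('a \<Rightarrow> 'a \<Rightarrow> complex) \<Rightarrow> ('a \<Rightarrow> complex) set \<Rightarrow> bool" where
  "rkhs_dense S K D \<longleftrightarrow> (\<forall>f\<in>rkhs S K. \<forall>e>0. \<exists>g\<in>D. rkhs_norm S K (\<lambda>x. f x - g x) < e)"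

definition graph_closure ::
  "('a \<Rightarrow> complex) set \<Rightarrow> (('a \<Rightarrow> complex) \<Rightarrow> real) \<Rightarrow>
   ('a \<Rightarrow> complex) set \<Rightarrow> (('a \<Rightarrow> complex) \<Rightarrow> real) \<Rightarrow>
   (('a \<Rightarrow> complex) \<times> ('a \<Rightarrow> complex)) set \<Rightarrow> (('a \<Rightarrow> complex) \<times> ('a \<Rightarrow> complex)) set" where
  "graph_closure V nV W nW A = {(f, g). f \<in> V \<and> g \<in> W \<and>
     (\<exists>s t. (\<forall>n. (s n, t n) \<in> A) \<and>
        (\<lambda>n::nat. nV (\<lambda>x. s n x - f x)) \<longlonglongrightarrow> 0 \<and> (\<lambda>n. nW (\<lambda>x. t n x - g x)) \<longlonglongrightarrow> 0)}"

text \<open>The closure of an operator from the RKHS to \<open>L\<^sup>2(M)\<close>, and of one from \<open>L\<^sup>2(M)\<close> to the RKHS.\<close>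

definition op_closure where
  "op_closure M K A =
     graph_closure (rkhs (space M) K) (rkhs_norm (space M) K) (L2 M) (L2_norm M) A"

definition op_closure' where
  "op_closure' M K A =
     graph_closure (L2 M) (L2_norm M) (rkhs (space M) K) (rkhs_norm (space M) K) A"

definition closable_op where
  "closable_op M K A \<longleftrightarrow> (\<forall>f g h. (f, g) \<in> op_closure M K A \<longrightarrow> (f, h) \<in> op_closure M K A \<longrightarrow>
     (AE x in M. g x = h x))"

definition adjoint_op where
  "adjoint_op M K A = {(\<psi>, h). \<psi> \<in> L2 M \<and> h \<in> rkhs (space M) K \<and>
     (\<forall>(f, g)\<in>A. rkhs_inner (space M) K f h = L2_inner M g \<psi>)}"

text \<open>The operator \<open>\<beta> I + A\<close>, with the domain of \<open>A\<close>.\<close>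

definition shift_op ::
  "real \<Rightarrow> (('a \<Rightarrow> complex) \<times> ('a \<Rightarrow> complex)) set \<Rightarrow> (('a \<Rightarrow> complex) \<times> ('a \<Rightarrow> complex)) set" where
  "shift_op \<beta> A = {(f, \<lambda>x. complex_of_real \<beta> * f x + h x) | f h. (f, h) \<in> A}"

definition op_apply :: "(('a \<Rightarrow> complex) \<times> ('a \<Rightarrow> complex)) set \<Rightarrow> ('a \<Rightarrow> complex) \<Rightarrow> 'a \<Rightarrow> complex" where
  "op_apply A f = (SOME g. (f, g) \<in> A)"

text \<open>The functional is \<open>\<infinity>\<close> off the domain of the operator.\<close>

definition tikhonov ::
  "'a measure \<Rightarrow> ('a \<Rightarrow> 'a \<Rightarrow> complex) \<Rightarrow> (('a \<Rightarrow> complex) \<times> ('a \<Rightarrow> complex)) set \<Rightarrow>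
   ('a \<Rightarrow> complex) \<Rightarrow> real \<Rightarrow> ('a \<Rightarrow> complex) \<Rightarrow> ereal" where
  "tikhonov M K A \<psi> \<beta> f =
     (if f \<in> Domain A
      then ereal ((L2_norm M (\<lambda>x. \<psi> x - op_apply A f x))\<^sup>2 + \<beta> * (rkhs_norm (space M) K f)\<^sup>2)
      else \<infinity>)"

text \<open>
  The operator \<open>(\<beta> I + T\<^sup>* T)\<inverse> T\<^sup>*\<close>; as usual for a closable operator, the factor \<open>T\<close> of \<open>T\<^sup>* T\<close>
  is the closure of \<open>T\<close>, which has the same adjoint.
\<close>

definition normal_op where
  "normal_op M K T = op_closure M K T O adjoint_op M K T"

definition regularized_inverse where
  "regularized_inverse M K T \<beta> = adjoint_op M K T O (shift_op \<beta> (normal_op M K T))\<inverse>"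

end

theory Submission
  imports Defs
begin

text \<open>
  Norm convergence in \<open>H(K)\<close> implies pointwise convergence, because \<open>\<bar>f y\<bar> \<le> \<parallel>K\<^sub>y\<parallel> \<parallel>f\<parallel>\<close>. Together with
  Fatou's lemma this makes the closure of \<open>T\<close> an evaluation operator again: an \<open>L\<^sup>2\<close>-Cauchy sequence
  that converges pointwise converges to that pointwise limit in \<open>L\<^sup>2\<close> (\<open>L2_Cauchy_pointwise\<close>). Hence the
  domain of the closure, \<open>closure_dom\<close>, is a space of functions on which the closure acts as the
  identity (\<open>op_closure_iff\<close>), and it is complete for the graph inner product
  \<open>\<langle>u, v\<rangle>\<^sub>\<beta> = \<langle>u, v\<rangle>\<^bsub>L2\<^esub> + \<beta> \<langle>u, v\<rangle>\<^bsub>H(K)\<^esub>\<close> (\<open>closure_dom_complete\<close>).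

  All claims then concern the weak equation \<open>\<langle>u, F\<rangle>\<^sub>\<beta> = \<phi>(u)\<close> for all \<open>u\<close> in \<open>closure_dom\<close>, which the
  Riesz theorem solves uniquely. For \<open>\<phi>(u) = \<langle>u, h\<rangle>\<^bsub>H(K)\<^esub>\<close> it says \<open>(\<beta> I + T\<^sup>* T) F = h\<close>
  (\<open>shift_op_iff\<close>). For \<open>\<phi>(u) = \<langle>u, \<psi>\<rangle>\<^bsub>L2\<^esub>\<close> (\<open>weak_solution\<close>) it is the Euler equation of the functional,
  and completing the square gives \<open>Q(f) = \<parallel>\<psi>\<parallel>\<^sup>2 - Re \<langle>F, \<psi>\<rangle> + \<parallel>f - F\<parallel>\<^sub>\<beta>\<^sup>2\<close> (\<open>tikhonov_eq\<close>), from which the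
  minimizer, its uniqueness and the value of the infimum over \<open>dom T\<close> are read off. When \<open>\<psi>\<close> lies in the
  domain of \<open>T\<^sup>*\<close>, the two right-hand sides agree with \<open>h = T\<^sup>* \<psi>\<close>, so \<open>F = (\<beta> I + T\<^sup>* T)\<^sup>-\<^sup>1 T\<^sup>* \<psi>\<close>.

  For general \<open>\<psi>\<close> the operator is extended by continuity: \<open>\<psi> \<mapsto> F\<close> is bounded (\<open>weak_solution_bound\<close>), and
  the domain of \<open>T\<^sup>*\<close> is dense in \<open>L\<^sup>2\<close> (\<open>Domain_adjoint_dense\<close>). Density comes from the regularization
  itself. If \<open>F\<^sub>n\<close> is the weak solution for parameter \<open>n + 1\<close>, the residual \<open>\<psi> - F\<^sub>n\<close> lies in the domain
  of \<open>T\<^sup>*\<close>; the energies \<open>Re \<langle>F\<^sub>n, \<psi>\<rangle>\<close> decrease and control \<open>\<parallel>F\<^sub>n - F\<^sub>m\<parallel>\<^sup>2\<close>, so \<open>(F\<^sub>n)\<close> is Cauchy in \<open>L\<^sup>2\<close>;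
  and \<open>F\<^sub>n\<close> tends to \<open>0\<close> in \<open>H(K)\<close>, hence pointwise, hence in \<open>L\<^sup>2\<close>.
\<close>

section \<open>Positive semidefinite forms and the Riesz theorem\<close>

definition form_norm ::
  "(('a \<Rightarrow> complex) \<Rightarrow> ('a \<Rightarrow> complex) \<Rightarrow> complex) \<Rightarrow> ('a \<Rightarrow> complex) \<Rightarrow> real" where
  "form_norm B u = sqrt (Re (B u u))"

definition form_Cauchy ::
  "(('a \<Rightarrow> complex) \<Rightarrow> ('a \<Rightarrow> complex) \<Rightarrow> complex) \<Rightarrow> (nat \<Rightarrow> 'a \<Rightarrow> complex) \<Rightarrow> bool" where
  "form_Cauchy B u \<longleftrightarrow>
     (\<forall>e>0. \<exists>N. \<forall>m\<ge>N. \<forall>n\<ge>N. form_norm B (\<lambda>x. u m x - u n x) < e)"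

lemma fun_subspace_add: "fun_subspace V \<Longrightarrow> u \<in> V \<Longrightarrow> v \<in> V \<Longrightarrow> (\<lambda>x. u x + v x) \<in> V"
  and fun_subspace_scale: "fun_subspace V \<Longrightarrow> u \<in> V \<Longrightarrow> (\<lambda>x. c * u x) \<in> V"
  by (auto simp: fun_subspace_def)

lemma fun_subspace_diff:
  assumes "fun_subspace V" "u \<in> V" "v \<in> V"
  shows "(\<lambda>x. u x - v x) \<in> V"
  using fun_subspace_add[OF assms(1,2) fun_subspace_scale[OF assms(1,3), of "-1"]] by simp

text \<open>
  The forms on kernel coefficients, on \<open>H(K)\<close>, on \<open>L\<^sup>2\<close> and on the graph of the closure are all positive
  semidefinite forms on subspaces of one function type. They are not definite in general: coefficients
  and representatives of \<open>L\<^sup>2\<close> classes can be nonzero and have norm \<open>0\<close>.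
\<close>

locale psd_form =
  fixes V :: "('a \<Rightarrow> complex) set"
    and B :: "('a \<Rightarrow> complex) \<Rightarrow> ('a \<Rightarrow> complex) \<Rightarrow> complex"
  assumes subspace: "fun_subspace V"
    and add_right: "\<lbrakk>u \<in> V; v \<in> V; w \<in> V\<rbrakk> \<Longrightarrow> B u (\<lambda>x. v x + w x) = B u v + B u w"
    and scale_right: "\<lbrakk>u \<in> V; v \<in> V\<rbrakk> \<Longrightarrow> B u (\<lambda>x. c * v x) = c * B u v"
    and herm: "\<lbrakk>u \<in> V; v \<in> V\<rbrakk> \<Longrightarrow> B v u = cnj (B u v)"
    and Re_nonneg: "u \<in> V \<Longrightarrow> 0 \<le> Re (B u u)"
begin

abbreviation nrm :: "('a \<Rightarrow> complex) \<Rightarrow> real" where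
  "nrm \<equiv> form_norm B"

lemma zero_mem: "(\<lambda>_. 0) \<in> V"
  and add_mem: "u \<in> V \<Longrightarrow> v \<in> V \<Longrightarrow> (\<lambda>x. u x + v x) \<in> V"
  and scale_mem: "u \<in> V \<Longrightarrow> (\<lambda>x. c * u x) \<in> V"
  using subspace unfolding fun_subspace_def by blast+

lemma diff_mem: "u \<in> V \<Longrightarrow> v \<in> V \<Longrightarrow> (\<lambda>x. u x - v x) \<in> V"
  by (rule fun_subspace_diff[OF subspace])

lemma diff_right:
  assumes "u \<in> V" "v \<in> V" "w \<in> V"
  shows "B u (\<lambda>x. v x - w x) = B u v - B u w"
  using add_right[OF assms(1,2) scale_mem[OF assms(3), of "-1"]]
    scale_right[OF assms(1,3), of "-1"] by simp

lemma add_left: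
  assumes "u \<in> V" "v \<in> V" "w \<in> V"
  shows "B (\<lambda>x. v x + w x) u = B v u + B w u"
  using add_right[OF assms] herm[OF assms(1) add_mem[OF assms(2,3)]]
    herm[OF assms(1,2)] herm[OF assms(1,3)] by simp

lemma scale_left:
  assumes "u \<in> V" "v \<in> V"
  shows "B (\<lambda>x. c * v x) u = cnj c * B v u"
  using scale_right[OF assms, of c] herm[OF assms(1) scale_mem[OF assms(2)], of c]
    herm[OF assms] by simp

lemma diff_left:
  assumes "u \<in> V" "v \<in> V" "w \<in> V"
  shows "B (\<lambda>x. v x - w x) u = B v u - B w u"
  using diff_right[OF assms] herm[OF assms(1) diff_mem[OF assms(2,3)]]
    herm[OF assms(1,2)] herm[OF assms(1,3)] by simp

lemma nrm_nonneg: "u \<in> V \<Longrightarrow> 0 \<le> nrm u"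
  by (simp add: form_norm_def Re_nonneg)

lemma nrm_power2: "u \<in> V \<Longrightarrow> (nrm u)\<^sup>2 = Re (B u u)"
  by (simp add: form_norm_def Re_nonneg)

lemma zero_right: "u \<in> V \<Longrightarrow> B u (\<lambda>_. 0) = 0"
  using scale_right[of u u 0] by simp

lemma nrm_zero: "nrm (\<lambda>_. 0) = 0"
  using zero_right[OF zero_mem] by (simp add: form_norm_def)

lemma nrm_scale:
  assumes "u \<in> V"
  shows "nrm (\<lambda>x. c * u x) = cmod c * nrm u"
proof -
  have "B (\<lambda>x. c * u x) (\<lambda>x. c * u x) = (cnj c * c) * B u u"
    using assms by (simp add: scale_left scale_right scale_mem)
  also have "\<dots> = of_real ((cmod c)\<^sup>2) * B u u"
    by (metis complex_norm_square mult.commute)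
  finally show ?thesis
    by (simp add: form_norm_def real_sqrt_mult Re_complex_of_real)
qed

lemma nrm_minus_commute:
  assumes "u \<in> V" "v \<in> V"
  shows "nrm (\<lambda>x. u x - v x) = nrm (\<lambda>x. v x - u x)"
  using nrm_scale[OF diff_mem[OF assms], of "-1"] by simp

lemma nrm_add_power2:
  assumes "u \<in> V" "v \<in> V"
  shows "(nrm (\<lambda>x. u x + v x))\<^sup>2 = (nrm u)\<^sup>2 + 2 * Re (B u v) + (nrm v)\<^sup>2"
proof -
  have "Re (B v u) = Re (B u v)" using herm[OF assms] by simp
  then show ?thesis
    using assms by (simp add: nrm_power2 add_mem add_left add_right)
qed

lemma nrm_diff_power2:
  assumes "u \<in> V" "v \<in> V"
  shows "(nrm (\<lambda>x. u x - v x))\<^sup>2 = (nrm u)\<^sup>2 - 2 * Re (B u v) + (nrm v)\<^sup>2"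
proof -
  have "Re (B v u) = Re (B u v)" using herm[OF assms] by simp
  then show ?thesis
    using assms by (simp add: nrm_power2 diff_mem diff_left diff_right)
qed

text \<open>
  The quadratic \<open>t \<mapsto> \<parallel>u - t v\<parallel>\<^sup>2\<close> is nonnegative. Since \<open>\<parallel>v\<parallel> = 0\<close> does not give \<open>v = 0\<close>, the degenerate
  cases need test values of \<open>t\<close> of their own; otherwise \<open>t = \<parallel>u\<parallel> / \<parallel>v\<parallel>\<close> suffices.
\<close>

lemma Re_Cauchy_Schwarz:
  assumes u: "u \<in> V" and v: "v \<in> V"
  shows "Re (B u v) \<le> nrm u * nrm v"
proof -
  have quad: "0 \<le> (nrm u)\<^sup>2 - 2 * t * Re (B u v) + t\<^sup>2 * (nrm v)\<^sup>2" for t :: real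
  proof -
    have "0 \<le> (nrm (\<lambda>x. u x - of_real t * v x))\<^sup>2" by simp
    also have "\<dots> = (nrm u)\<^sup>2 - 2 * t * Re (B u v) + t\<^sup>2 * (nrm v)\<^sup>2"
      using assms by (simp add: nrm_diff_power2 scale_mem nrm_scale scale_right power_mult_distrib)
    finally show ?thesis .
  qed
  show ?thesis
  proof (cases "nrm v = 0")
    case True
    have "Re (B u v) \<le> 0"
    proof (rule ccontr)
      assume neg: "\<not> Re (B u v) \<le> 0"
      have "0 \<le> (nrm u)\<^sup>2 - 2 * (((nrm u)\<^sup>2 + 1) / (2 * Re (B u v))) * Re (B u v)"
        using quad[of "((nrm u)\<^sup>2 + 1) / (2 * Re (B u v))"] True by simp
      then show False using neg by simp
    qed
    then show ?thesis using True by simp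
  next
    case False
    then have pos: "0 < nrm v" using nrm_nonneg[OF v] by simp
    show ?thesis
    proof (cases "nrm u = 0")
      case True
      have "0 \<le> - 2 * t * Re (B u v) + t\<^sup>2 * (nrm v)\<^sup>2" for t :: real
        using quad[of t] True by simp
      from this[of "Re (B u v) / (nrm v)\<^sup>2"] have "(Re (B u v))\<^sup>2 / (nrm v)\<^sup>2 \<le> 0"
        using pos by (simp add: field_simps power2_eq_square)
      then show ?thesis using True pos by (simp add: divide_le_0_iff)
    next
      case False
      then have pos': "0 < nrm u" using nrm_nonneg[OF u] by simp
      have "0 \<le> (nrm u)\<^sup>2 - 2 * (nrm u / nrm v) * Re (B u v) + (nrm u / nrm v)\<^sup>2 * (nrm v)\<^sup>2"
        by (rule quad)
      also have "(nrm u / nrm v)\<^sup>2 * (nrm v)\<^sup>2 = (nrm u)\<^sup>2"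
        using pos by (simp add: field_simps)
      finally have "(nrm u / nrm v) * Re (B u v) \<le> nrm u * nrm u"
        by (simp add: power2_eq_square)
      then show ?thesis using pos pos' by (simp add: field_simps)
    qed
  qed
qed

lemma Cauchy_Schwarz:
  assumes u: "u \<in> V" and v: "v \<in> V"
  shows "cmod (B u v) \<le> nrm u * nrm v"
proof (cases "B u v = 0")
  case True
  then show ?thesis using nrm_nonneg u v by simp
next
  case False
  \<comment> \<open>rotating \<open>v\<close> by a unit scalar makes \<open>B u v\<close> real and nonnegative\<close>
  define c where "c = cnj (B u v) / of_real (cmod (B u v))"
  have c1: "cmod c = 1" using False by (simp add: c_def norm_divide)
  have "B u (\<lambda>x. c * v x) = c * B u v" using u v by (rule scale_right)
  also have "\<dots> = (B u v * cnj (B u v)) / of_real (cmod (B u v))"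
    by (simp add: c_def mult.commute)
  also have "\<dots> = of_real (cmod (B u v))"
    using False unfolding complex_norm_square[symmetric] by (simp add: power2_eq_square)
  finally have "cmod (B u v) \<le> nrm u * nrm (\<lambda>x. c * v x)"
    using Re_Cauchy_Schwarz[OF u scale_mem[OF v, of c]] by simp
  then show ?thesis using c1 v by (simp add: nrm_scale)
qed

lemma nrm_triangle:
  assumes "u \<in> V" "v \<in> V"
  shows "nrm (\<lambda>x. u x + v x) \<le> nrm u + nrm v"
proof (rule power2_le_imp_le)
  show "(nrm (\<lambda>x. u x + v x))\<^sup>2 \<le> (nrm u + nrm v)\<^sup>2"
    using Re_Cauchy_Schwarz[OF assms] by (simp add: nrm_add_power2[OF assms] power2_sum)
  show "0 \<le> nrm u + nrm v" using assms nrm_nonneg by simp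
qed

lemma nrm_diff_triangle:
  assumes "u \<in> V" "v \<in> V" "w \<in> V"
  shows "nrm (\<lambda>x. u x - w x) \<le> nrm (\<lambda>x. u x - v x) + nrm (\<lambda>x. v x - w x)"
  using nrm_triangle[OF diff_mem[OF assms(1,2)] diff_mem[OF assms(2,3)]] by simp

lemma nrm_le_add_diff:
  assumes "u \<in> V" "v \<in> V"
  shows "nrm u \<le> nrm v + nrm (\<lambda>x. u x - v x)"
  using nrm_triangle[OF assms(2) diff_mem[OF assms]] by simp

lemma abs_nrm_diff_le:
  assumes "u \<in> V" "v \<in> V"
  shows "\<bar>nrm u - nrm v\<bar> \<le> nrm (\<lambda>x. u x - v x)"
  using nrm_le_add_diff[OF assms] nrm_le_add_diff[OF assms(2,1)] nrm_minus_commute[OF assms]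
  by simp

lemma nrm_add_diff_le:
  assumes "u \<in> V" "v \<in> V" "f \<in> V" "g \<in> V"
  shows "nrm (\<lambda>x. (u x + v x) - (f x + g x)) \<le> nrm (\<lambda>x. u x - f x) + nrm (\<lambda>x. v x - g x)"
  using nrm_triangle[OF diff_mem[OF assms(1,3)] diff_mem[OF assms(2,4)]]
  by (simp add: algebra_simps)

lemma nrm_scale_diff:
  assumes "u \<in> V" "f \<in> V"
  shows "nrm (\<lambda>x. c * u x - c * f x) = cmod c * nrm (\<lambda>x. u x - f x)"
  using nrm_scale[OF diff_mem[OF assms], of c] by (simp add: algebra_simps)

lemma form_diff_bound:
  assumes "u \<in> V" "u' \<in> V" "v \<in> V" "v' \<in> V"
  shows "cmod (B u v - B u' v')
      \<le> nrm (\<lambda>x. u x - u' x) * nrm v + nrm u' * nrm (\<lambda>x. v x - v' x)"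
proof -
  have "B u v - B u' v' = B (\<lambda>x. u x - u' x) v + B u' (\<lambda>x. v x - v' x)"
    using assms by (simp add: diff_left diff_right)
  also have "cmod \<dots> \<le> cmod (B (\<lambda>x. u x - u' x) v) + cmod (B u' (\<lambda>x. v x - v' x))"
    by (rule norm_triangle_ineq)
  also have "\<dots> \<le> nrm (\<lambda>x. u x - u' x) * nrm v + nrm u' * nrm (\<lambda>x. v x - v' x)"
    using assms by (intro add_mono Cauchy_Schwarz diff_mem)
  finally show ?thesis .
qed

lemma nrm_tendsto:
  assumes "\<And>n. u n \<in> V" "f \<in> V" "(\<lambda>n. nrm (\<lambda>x. u n x - f x)) \<longlonglongrightarrow> 0"
  shows "(\<lambda>n. nrm (u n)) \<longlonglongrightarrow> nrm f"
proof -
  have "(\<lambda>n. nrm (u n) - nrm f) \<longlonglongrightarrow> 0"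
    by (rule Lim_null_comparison[OF _ assms(3)]) (use abs_nrm_diff_le assms(1,2) in auto)
  then show ?thesis by (simp only: LIM_zero_iff)
qed

lemma nrm_limit_unique:
  assumes u: "\<And>n. u n \<in> V" and f: "f \<in> V" and g: "g \<in> V"
    and f_lim: "(\<lambda>n. nrm (\<lambda>x. u n x - f x)) \<longlonglongrightarrow> 0" and g_lim: "(\<lambda>n. nrm (\<lambda>x. u n x - g x)) \<longlonglongrightarrow> 0"
  shows "nrm (\<lambda>x. f x - g x) = 0"
proof -
  have "nrm (\<lambda>x. f x - g x) \<le> nrm (\<lambda>x. u n x - f x) + nrm (\<lambda>x. u n x - g x)" for n
    using nrm_diff_triangle[OF f u g, of n] nrm_minus_commute[OF f u, of n] by simp
  moreover have "(\<lambda>n. nrm (\<lambda>x. u n x - f x) + nrm (\<lambda>x. u n x - g x)) \<longlonglongrightarrow> 0"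
    using tendsto_add[OF f_lim g_lim] by simp
  ultimately have "nrm (\<lambda>x. f x - g x) \<le> 0"
    by (intro LIMSEQ_le_const) auto
  then show ?thesis using nrm_nonneg[OF diff_mem[OF f g]] by simp
qed

lemma form_tendsto:
  assumes "\<And>n. u n \<in> V" "\<And>n. v n \<in> V" "f \<in> V" "g \<in> V"
    and "(\<lambda>n. nrm (\<lambda>x. u n x - f x)) \<longlonglongrightarrow> 0" "(\<lambda>n. nrm (\<lambda>x. v n x - g x)) \<longlonglongrightarrow> 0"
  shows "(\<lambda>n. B (u n) (v n)) \<longlonglongrightarrow> B f g"
proof -
  have "(\<lambda>n. nrm (\<lambda>x. u n x - f x) * nrm (v n) + nrm f * nrm (\<lambda>x. v n x - g x))
      \<longlonglongrightarrow> 0 * nrm g + nrm f * 0"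
    using assms nrm_tendsto by (intro tendsto_intros) auto
  then have lim: "(\<lambda>n. nrm (\<lambda>x. u n x - f x) * nrm (v n) + nrm f * nrm (\<lambda>x. v n x - g x))
      \<longlonglongrightarrow> 0" by simp
  have "(\<lambda>n. B (u n) (v n) - B f g) \<longlonglongrightarrow> 0"
    by (rule Lim_null_comparison[OF always_eventually lim])
       (intro allI form_diff_bound assms)
  then show ?thesis by (simp only: LIM_zero_iff)
qed

lemma form_tendsto_left:
  assumes "\<And>n. u n \<in> V" "f \<in> V" "g \<in> V" "(\<lambda>n. nrm (\<lambda>x. u n x - f x)) \<longlonglongrightarrow> 0"
  shows "(\<lambda>n. B (u n) g) \<longlonglongrightarrow> B f g"
  using form_tendsto[of u "\<lambda>_. g" f g] assms nrm_zero by simp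

lemma form_Cauchy_nrm_bounded:
  assumes "\<And>n. u n \<in> V" "form_Cauchy B u"
  obtains C where "0 < C" "\<And>n. nrm (u n) \<le> C"
proof -
  have "Cauchy (\<lambda>n. nrm (u n))"
    unfolding Cauchy_def
  proof (intro allI impI)
    fix e :: real assume "0 < e"
    then obtain N where N: "\<forall>m\<ge>N. \<forall>n\<ge>N. nrm (\<lambda>x. u m x - u n x) < e"
      using assms(2) unfolding form_Cauchy_def by blast
    show "\<exists>N. \<forall>m\<ge>N. \<forall>n\<ge>N. dist (nrm (u m)) (nrm (u n)) < e"
      unfolding dist_real_def using N abs_nrm_diff_le[OF assms(1) assms(1)] by (meson le_less_trans)
  qed
  then obtain C where "0 < C" "\<And>n. norm (nrm (u n)) \<le> C"
    using Cauchy_Bseq BseqE by metis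
  then show ?thesis using that by (metis abs_le_D1 real_norm_def)
qed

lemma form_Cauchy_convergent:
  assumes "\<And>n. u n \<in> V" "form_Cauchy B u" "\<And>n. v n \<in> V" "form_Cauchy B v"
  shows "convergent (\<lambda>n. B (u n) (v n))"
proof -
  obtain C where C: "0 < C" "\<And>n. nrm (u n) \<le> C"
    using form_Cauchy_nrm_bounded assms(1,2) by blast
  obtain E where E: "0 < E" "\<And>n. nrm (v n) \<le> E"
    using form_Cauchy_nrm_bounded assms(3,4) by blast
  have "Cauchy (\<lambda>n. B (u n) (v n))"
    unfolding Cauchy_def
  proof (intro allI impI)
    fix e :: real assume e: "0 < e"
    obtain N where N: "\<And>m n. m \<ge> N \<Longrightarrow> n \<ge> N \<Longrightarrow> nrm (\<lambda>x. u m x - u n x) < e / (2 * E)"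
      using assms(2) e E(1) unfolding form_Cauchy_def
      by (metis divide_pos_pos mult_pos_pos zero_less_numeral)
    obtain N' where N': "\<And>m n. m \<ge> N' \<Longrightarrow> n \<ge> N' \<Longrightarrow> nrm (\<lambda>x. v m x - v n x) < e / (2 * C)"
      using assms(4) e C(1) unfolding form_Cauchy_def
      by (metis divide_pos_pos mult_pos_pos zero_less_numeral)
    have "dist (B (u m) (v m)) (B (u n) (v n)) < e" if "m \<ge> max N N'" "n \<ge> max N N'" for m n
    proof -
      have "cmod (B (u m) (v m) - B (u n) (v n))
          \<le> nrm (\<lambda>x. u m x - u n x) * nrm (v m) + nrm (u n) * nrm (\<lambda>x. v m x - v n x)"
        using assms by (intro form_diff_bound) auto
      also have "\<dots> \<le> nrm (\<lambda>x. u m x - u n x) * E + C * nrm (\<lambda>x. v m x - v n x)"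
        using assms C E by (intro add_mono mult_mono nrm_nonneg diff_mem) auto
      also have "\<dots> < e / (2 * E) * E + C * (e / (2 * C))"
        using N[of m n] N'[of m n] that C(1) E(1)
        by (intro add_strict_mono mult_strict_right_mono mult_strict_left_mono) auto
      also have "\<dots> = e" using C(1) E(1) by (simp add: field_simps)
      finally show ?thesis by (simp add: dist_norm)
    qed
    then show "\<exists>N. \<forall>m\<ge>N. \<forall>n\<ge>N. dist (B (u m) (v m)) (B (u n) (v n)) < e" by blast
  qed
  then show ?thesis by (simp add: Cauchy_convergent_iff)
qed

lemma nrm_diff_LIMSEQ_Cauchy:
  assumes "\<And>n. u n \<in> V" "f \<in> V" "(\<lambda>n. nrm (\<lambda>x. u n x - f x)) \<longlonglongrightarrow> 0"
  shows "form_Cauchy B u"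
  unfolding form_Cauchy_def
proof (intro allI impI)
  fix e :: real assume "0 < e"
  then obtain N where N: "\<And>n. n \<ge> N \<Longrightarrow> norm (nrm (\<lambda>x. u n x - f x)) < e / 2"
    using LIMSEQ_D[OF assms(3), of "e / 2"] by auto
  have "nrm (\<lambda>x. u m x - u n x) < e" if "m \<ge> N" "n \<ge> N" for m n
    using nrm_diff_triangle[OF assms(1) assms(2) assms(1), of m n] N[OF that(1)] N[OF that(2)]
      nrm_minus_commute[OF assms(1) assms(2), of n] by simp
  then show "\<exists>N. \<forall>m\<ge>N. \<forall>n\<ge>N. nrm (\<lambda>x. u m x - u n x) < e" by blast
qed

text \<open>
  The representing element is the minimizer of \<open>J(u) = \<parallel>u\<parallel>\<^sup>2 - 2 Re \<phi>(u)\<close>. By the parallelogram law a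
  minimizing sequence is Cauchy, and the first variation of \<open>J\<close> at the limit vanishes.
\<close>

theorem Riesz_representation:
  assumes complete: "\<And>u. (\<And>n. u n \<in> V) \<Longrightarrow> form_Cauchy B u \<Longrightarrow>
        \<exists>f\<in>V. (\<lambda>n. nrm (\<lambda>x. u n x - f x)) \<longlonglongrightarrow> 0"
    and \<phi>_add: "\<And>u v. u \<in> V \<Longrightarrow> v \<in> V \<Longrightarrow> \<phi> (\<lambda>x. u x + v x) = \<phi> u + \<phi> v"
    and \<phi>_scale: "\<And>u c. u \<in> V \<Longrightarrow> \<phi> (\<lambda>x. c * u x) = cnj c * \<phi> u"
    and bound: "\<And>u. u \<in> V \<Longrightarrow> cmod (\<phi> u) \<le> C * nrm u"
  shows "\<exists>f\<in>V. \<forall>u\<in>V. B u f = \<phi> u"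
proof -
  define J where "J u = (nrm u)\<^sup>2 - 2 * Re (\<phi> u)" for u
  have Re_bound: "Re (\<phi> u) \<le> C * nrm u" if "u \<in> V" for u
    using bound[OF that] complex_Re_le_cmod[of "\<phi> u"] by linarith
  have "- C\<^sup>2 \<le> J u" if "u \<in> V" for u
  proof -
    have "0 \<le> (nrm u - C)\<^sup>2" by simp
    then show ?thesis using Re_bound[OF that] by (simp add: J_def power2_diff mult.commute)
  qed
  then have bdd: "bdd_below (J ` V)" by (intro bdd_belowI2[of _ "- C\<^sup>2"]) auto
  define I where "I = Inf (J ` V)"
  have I_le: "I \<le> J u" if "u \<in> V" for u
    unfolding I_def using bdd that by (rule cINF_lower)
  have "\<exists>u\<in>V. J u < I + 1 / Suc n" for n
  proof -
    have "I < I + 1 / Suc n" by simp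
    then show ?thesis
      unfolding I_def using cInf_lessD[of "J ` V"] zero_mem by blast
  qed
  then obtain u where u: "\<And>n. u n \<in> V" and Ju: "\<And>n. J (u n) < I + 1 / Suc n" by metis
  have parallelogram: "(nrm (\<lambda>x. v x - w x))\<^sup>2 \<le> 2 * J v + 2 * J w - 4 * I"
    if v: "v \<in> V" and w: "w \<in> V" for v w
  proof -
    define z where "z = (\<lambda>x. (1/2) * (v x + w x))"
    have z: "z \<in> V" unfolding z_def using v w by (intro scale_mem add_mem)
    have "nrm z = (1/2) * nrm (\<lambda>x. v x + w x)"
      unfolding z_def using nrm_scale[OF add_mem[OF v w], of "1/2"] by (simp add: norm_divide)
    then have "(nrm z)\<^sup>2 = (1/4) * (nrm (\<lambda>x. v x + w x))\<^sup>2"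
      by (simp only: power_mult_distrib) (simp add: power2_eq_square)
    moreover have "\<phi> z = (1/2) * (\<phi> v + \<phi> w)"
      unfolding z_def using \<phi>_scale[OF add_mem[OF v w], of "1/2"] \<phi>_add[OF v w] by simp
    then have "Re (\<phi> z) = Re ((1/2) * (\<phi> v + \<phi> w))" by (rule arg_cong)
    then have "Re (\<phi> z) = (1/2) * (Re (\<phi> v) + Re (\<phi> w))" by simp
    ultimately have "(nrm (\<lambda>x. v x - w x))\<^sup>2 = 2 * J v + 2 * J w - 4 * J z"
      by (simp add: J_def nrm_add_power2[OF v w] nrm_diff_power2[OF v w])
    then show ?thesis using I_le[OF z] by simp
  qed
  have "form_Cauchy B u"
    unfolding form_Cauchy_def
  proof (intro allI impI)
    fix e :: real assume e: "0 < e"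
    then obtain N where N: "inverse (real (Suc N)) < e\<^sup>2 / 4"
      using reals_Archimedean[of "e\<^sup>2 / 4"] by auto
    have "nrm (\<lambda>x. u m x - u n x) < e" if "m \<ge> N" "n \<ge> N" for m n
    proof -
      have "1 / real (Suc k) \<le> inverse (real (Suc N))" if "k \<ge> N" for k
        using that by (simp add: field_simps)
      from this[OF that(1)] this[OF that(2)] N Ju[of m] Ju[of n]
      have "J (u m) < I + e\<^sup>2 / 4" "J (u n) < I + e\<^sup>2 / 4"
        by linarith+
      then have "(nrm (\<lambda>x. u m x - u n x))\<^sup>2 < e\<^sup>2"
        using parallelogram[OF u u, of m n] by simp
      then show ?thesis using e by (simp add: power_less_imp_less_base)
    qed
    then show "\<exists>N. \<forall>m\<ge>N. \<forall>n\<ge>N. nrm (\<lambda>x. u m x - u n x) < e" by blast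
  qed
  then obtain f where f: "f \<in> V" and lim: "(\<lambda>n. nrm (\<lambda>x. u n x - f x)) \<longlonglongrightarrow> 0"
    using complete u by blast
  have "(\<lambda>n. \<phi> (u n) - \<phi> f) \<longlonglongrightarrow> 0"
  proof (rule Lim_null_comparison)
    show "\<forall>\<^sub>F n in sequentially. norm (\<phi> (u n) - \<phi> f) \<le> C * nrm (\<lambda>x. u n x - f x)"
    proof (intro always_eventually allI)
      fix n
      have "\<phi> (u n) = \<phi> (\<lambda>x. u n x - f x) + \<phi> f"
        using \<phi>_add[OF diff_mem[OF u f] f, of n] by simp
      then show "norm (\<phi> (u n) - \<phi> f) \<le> C * nrm (\<lambda>x. u n x - f x)"
        using bound[OF diff_mem[OF u f], of n] by simp
    qed
    show "(\<lambda>n. C * nrm (\<lambda>x. u n x - f x)) \<longlonglongrightarrow> 0" using tendsto_mult_right_zero[OF lim] .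
  qed
  then have "(\<lambda>n. \<phi> (u n)) \<longlonglongrightarrow> \<phi> f" by (simp only: LIM_zero_iff)
  then have "(\<lambda>n. J (u n)) \<longlonglongrightarrow> J f"
    unfolding J_def using nrm_tendsto[OF u f lim] by (intro tendsto_intros)
  moreover have "(\<lambda>n. I + 1 / real (Suc n)) \<longlonglongrightarrow> I + 0"
    by (intro tendsto_intros LIMSEQ_inverse_real_of_nat[unfolded inverse_eq_divide])
  ultimately have Jf: "J f \<le> I"
    using LIMSEQ_le[of "\<lambda>n. J (u n)" "J f" "\<lambda>n. I + 1 / real (Suc n)" I] Ju
    by (metis add.right_neutral less_imp_le)
  have Re_eq: "Re (B v f) = Re (\<phi> v)" if v: "v \<in> V" for v
  proof -
    define d where "d = Re (B v f) - Re (\<phi> v)"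
    have quad: "0 \<le> 2 * t * d + t\<^sup>2 * (nrm v)\<^sup>2" for t :: real
    proof -
      have tv: "(\<lambda>x. of_real t * v x) \<in> V" using v by (rule scale_mem)
      have "J f \<le> J (\<lambda>x. f x + of_real t * v x)"
        using Jf I_le[OF add_mem[OF f tv]] by simp
      moreover have "Re (B f v) = Re (B v f)" using herm[OF v f] by simp
      ultimately show ?thesis
        using v by (simp add: J_def d_def nrm_add_power2[OF f tv] \<phi>_add[OF f tv] \<phi>_scale
            scale_right[OF f v] nrm_scale power_mult_distrib algebra_simps)
    qed
    \<comment> \<open>the \<open>+ 1\<close> keeps the step \<open>- d / q\<close> defined when \<open>\<parallel>v\<parallel> = 0\<close>\<close>
    define q where "q = (nrm v)\<^sup>2 + 1"
    have q: "q > 0" "(nrm v)\<^sup>2 \<le> q" by (simp_all add: q_def add_nonneg_pos)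
    have "0 \<le> 2 * (- d / q) * d + (- d / q)\<^sup>2 * (nrm v)\<^sup>2" by (rule quad)
    also have "\<dots> \<le> 2 * (- d / q) * d + (- d / q)\<^sup>2 * q"
      using q(2) by (intro add_left_mono mult_left_mono) auto
    also have "\<dots> = - d\<^sup>2 / q" using q(1) by (simp add: field_simps power2_eq_square)
    finally have "d\<^sup>2 \<le> 0" using q(1) by (simp add: divide_le_0_iff)
    then show ?thesis by (simp add: d_def)
  qed
  have "B v f = \<phi> v" if v: "v \<in> V" for v
  proof (rule complex_eqI)
    show "Re (B v f) = Re (\<phi> v)" using Re_eq v .
    show "Im (B v f) = Im (\<phi> v)"
      using Re_eq[OF scale_mem[OF v, of \<i>]] scale_left[OF f v, of \<i>] \<phi>_scale[OF v, of \<i>] by simp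
  qed
  then show ?thesis using f by blast
qed

end

section \<open>The form on kernel coefficients\<close>

lemma fun_subspace_kernel_coeffs: "fun_subspace (kernel_coeffs S)"
  unfolding fun_subspace_def
proof (intro conjI ballI allI)
  show "(\<lambda>_. 0) \<in> kernel_coeffs S" by (simp add: kernel_coeffs_def)
  fix c d assume c: "c \<in> kernel_coeffs S"
  have "{x. a * c x \<noteq> 0} \<subseteq> {x. c x \<noteq> 0}" for a by auto
  then show "(\<lambda>x. a * c x) \<in> kernel_coeffs S" for a
    using c unfolding kernel_coeffs_def by (blast intro: finite_subset)
  assume d: "d \<in> kernel_coeffs S"
  have "{x. c x + d x \<noteq> 0} \<subseteq> {x. c x \<noteq> 0} \<union> {x. d x \<noteq> 0}" by auto
  then show "(\<lambda>x. c x + d x) \<in> kernel_coeffs S"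
    using c d unfolding kernel_coeffs_def by (blast intro: finite_subset)
qed

lemma kernel_form_eq:
  assumes "finite A" "{x. c x \<noteq> 0} \<subseteq> A" "finite B" "{x. d x \<noteq> 0} \<subseteq> B"
  shows "kernel_form K c d = (\<Sum>x\<in>A. \<Sum>y\<in>B. cnj (c x) * d y * K x y)"
proof -
  have "kernel_form K c d = (\<Sum>x | c x \<noteq> 0. \<Sum>y\<in>B. cnj (c x) * d y * K x y)"
    unfolding kernel_form_def
    by (intro sum.cong refl sum.mono_neutral_left assms(3,4)) auto
  also have "\<dots> = (\<Sum>x\<in>A. \<Sum>y\<in>B. cnj (c x) * d y * K x y)"
    by (intro sum.mono_neutral_left assms(1,2)) auto
  finally show ?thesis .
qed

lemma kernel_form_add_right:
  assumes "u \<in> kernel_coeffs S" "v \<in> kernel_coeffs S" "w \<in> kernel_coeffs S"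
  shows "kernel_form K u (\<lambda>x. v x + w x) = kernel_form K u v + kernel_form K u w"
proof -
  let ?A = "{x. u x \<noteq> 0}" and ?B = "{x. v x \<noteq> 0} \<union> {x. w x \<noteq> 0}"
  have fin: "finite ?A" "finite ?B" using assms by (auto simp: kernel_coeffs_def)
  have "kernel_form K u (\<lambda>x. v x + w x) = (\<Sum>x\<in>?A. \<Sum>y\<in>?B. cnj (u x) * (v y + w y) * K x y)"
    by (rule kernel_form_eq[OF fin(1) subset_refl fin(2)]) auto
  moreover have "kernel_form K u v = (\<Sum>x\<in>?A. \<Sum>y\<in>?B. cnj (u x) * v y * K x y)"
    by (rule kernel_form_eq[OF fin(1) subset_refl fin(2)]) auto
  moreover have "kernel_form K u w = (\<Sum>x\<in>?A. \<Sum>y\<in>?B. cnj (u x) * w y * K x y)"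
    by (rule kernel_form_eq[OF fin(1) subset_refl fin(2)]) auto
  ultimately show ?thesis by (simp add: sum.distrib algebra_simps)
qed

lemma kernel_form_scale_right:
  assumes "u \<in> kernel_coeffs S" "v \<in> kernel_coeffs S"
  shows "kernel_form K u (\<lambda>x. a * v x) = a * kernel_form K u v"
proof -
  let ?A = "{x. u x \<noteq> 0}" and ?B = "{x. v x \<noteq> 0}"
  have fin: "finite ?A" "finite ?B" using assms by (auto simp: kernel_coeffs_def)
  have "kernel_form K u (\<lambda>x. a * v x) = (\<Sum>x\<in>?A. \<Sum>y\<in>?B. cnj (u x) * (a * v y) * K x y)"
    by (rule kernel_form_eq[OF fin(1) subset_refl fin(2)]) auto
  then show ?thesis by (simp add: kernel_form_def sum_distrib_left algebra_simps)
qed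

lemma kernel_form_add_left:
  assumes "u \<in> kernel_coeffs S" "v \<in> kernel_coeffs S" "w \<in> kernel_coeffs S"
  shows "kernel_form K (\<lambda>x. v x + w x) u = kernel_form K v u + kernel_form K w u"
proof -
  let ?A = "{x. u x \<noteq> 0}" and ?B = "{x. v x \<noteq> 0} \<union> {x. w x \<noteq> 0}"
  have fin: "finite ?A" "finite ?B" using assms by (auto simp: kernel_coeffs_def)
  have "kernel_form K (\<lambda>x. v x + w x) u = (\<Sum>x\<in>?B. \<Sum>y\<in>?A. cnj (v x + w x) * u y * K x y)"
    by (rule kernel_form_eq[OF fin(2) _ fin(1) subset_refl]) auto
  moreover have "kernel_form K v u = (\<Sum>x\<in>?B. \<Sum>y\<in>?A. cnj (v x) * u y * K x y)"
    by (rule kernel_form_eq[OF fin(2) _ fin(1) subset_refl]) auto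
  moreover have "kernel_form K w u = (\<Sum>x\<in>?B. \<Sum>y\<in>?A. cnj (w x) * u y * K x y)"
    by (rule kernel_form_eq[OF fin(2) _ fin(1) subset_refl]) auto
  ultimately show ?thesis by (simp add: sum.distrib algebra_simps)
qed

lemma kernel_form_scale_left:
  assumes "u \<in> kernel_coeffs S" "v \<in> kernel_coeffs S"
  shows "kernel_form K (\<lambda>x. a * v x) u = cnj a * kernel_form K v u"
proof -
  let ?A = "{x. u x \<noteq> 0}" and ?B = "{x. v x \<noteq> 0}"
  have fin: "finite ?A" "finite ?B" using assms by (auto simp: kernel_coeffs_def)
  have "kernel_form K (\<lambda>x. a * v x) u = (\<Sum>x\<in>?B. \<Sum>y\<in>?A. cnj (a * v x) * u y * K x y)"
    by (rule kernel_form_eq[OF fin(2) _ fin(1) subset_refl]) auto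
  then show ?thesis by (simp add: kernel_form_def sum_distrib_left algebra_simps)
qed

lemma kernel_form_self:
  assumes K: "pos_def_kernel S K" and c: "c \<in> kernel_coeffs S"
  shows "kernel_form K c c \<in> \<real>\<^sub>\<ge>\<^sub>0"
proof -
  let ?A = "{x. c x \<noteq> 0}"
  have fin: "finite ?A" and sub: "?A \<subseteq> S" using c by (auto simp: kernel_coeffs_def)
  obtain p :: "nat \<Rightarrow> 'a" where p: "bij_betw p {..<card ?A} ?A"
    using ex_bij_betw_nat_finite[OF fin] by (auto simp: atLeast0LessThan)
  have "\<forall>i<card ?A. p i \<in> S" using p sub by (auto simp: bij_betw_def)
  then have "(\<Sum>i<card ?A. \<Sum>j<card ?A. cnj (c (p i)) * c (p j) * K (p i) (p j)) \<in> \<real>\<^sub>\<ge>\<^sub>0"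
    using K[unfolded pos_def_kernel_def, rule_format, of "card ?A" p "\<lambda>i. c (p i)"] by simp
  also have "(\<Sum>i<card ?A. \<Sum>j<card ?A. cnj (c (p i)) * c (p j) * K (p i) (p j))
      = (\<Sum>i<card ?A. \<Sum>y\<in>?A. cnj (c (p i)) * c y * K (p i) y)"
    by (intro sum.cong refl sum.reindex_bij_betw[OF p])
  also have "\<dots> = kernel_form K c c"
    unfolding kernel_form_def by (rule sum.reindex_bij_betw[OF p])
  finally show ?thesis .
qed

text \<open>
  Positivity over \<^typ>\<open>complex\<close> already forces the form to be Hermitian: the forms of \<open>u + v\<close> and
  of \<open>u + \<i> v\<close> are real, and these are the imaginary and the real part of the identity.
\<close>

lemma kernel_form_hermitian:
  assumes K: "pos_def_kernel S K" and u: "u \<in> kernel_coeffs S" and v: "v \<in> kernel_coeffs S"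
  shows "kernel_form K v u = cnj (kernel_form K u v)"
proof -
  have real: "Im (kernel_form K c c) = 0" if "c \<in> kernel_coeffs S" for c
    using kernel_form_self[OF K that] by (auto simp: complex_nonneg_Reals_iff)
  have expand: "kernel_form K (\<lambda>x. u x + a * v x) (\<lambda>x. u x + a * v x)
      = kernel_form K u u + a * kernel_form K u v + cnj a * kernel_form K v u
        + cnj a * a * kernel_form K v v" for a
  proof -
    have av: "(\<lambda>x. a * v x) \<in> kernel_coeffs S"
      by (rule fun_subspace_scale[OF fun_subspace_kernel_coeffs v])
    have uav: "(\<lambda>x. u x + a * v x) \<in> kernel_coeffs S"
      by (rule fun_subspace_add[OF fun_subspace_kernel_coeffs u av])
    show ?thesis
      by (simp add: kernel_form_add_left[OF uav u av] kernel_form_scale_left[OF uav v]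
          kernel_form_add_right[OF u u av] kernel_form_add_right[OF v u av]
          kernel_form_scale_right[OF u v] kernel_form_scale_right[OF v v] algebra_simps)
  qed
  have mem: "(\<lambda>x. u x + a * v x) \<in> kernel_coeffs S" for a
    by (intro fun_subspace_add fun_subspace_scale fun_subspace_kernel_coeffs u v)
  have "Im (kernel_form K u v) + Im (kernel_form K v u) = 0"
    using arg_cong[OF expand[of 1], of Im] real[OF mem[of 1]] real[OF u] real[OF v] by simp
  moreover have "Re (kernel_form K u v) - Re (kernel_form K v u) = 0"
    using arg_cong[OF expand[of \<i>], of Im] real[OF mem[of \<i>]] real[OF u] real[OF v] by simp
  ultimately show ?thesis by (simp add: complex_eq_iff)
qed

definition delta :: "'a \<Rightarrow> 'a \<Rightarrow> complex" where
  "delta y = (\<lambda>x. if x = y then 1 else 0)"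

lemma delta_support: "{x. delta y x \<noteq> 0} = {y}"
  by (auto simp: delta_def)

lemma delta_mem: "y \<in> S \<Longrightarrow> delta y \<in> kernel_coeffs S"
  unfolding kernel_coeffs_def by (simp add: delta_support)

lemma kernel_comb_eq_form:
  assumes "y \<in> S"
  shows "kernel_comb S K c y = kernel_form K (delta y) c"
  unfolding kernel_comb_def kernel_form_def delta_support
  using assms by (simp add: delta_def)

section \<open>The reproducing kernel Hilbert space\<close>

locale pd_kernel =
  fixes S :: "'a set" and K :: "'a \<Rightarrow> 'a \<Rightarrow> complex"
  assumes pos_def: "pos_def_kernel S K"
begin

sublocale coeffs: psd_form "kernel_coeffs S" "kernel_form K"
proof
  show "0 \<le> Re (kernel_form K u u)" if "u \<in> kernel_coeffs S" for u
    using kernel_form_self[OF pos_def that] by (auto simp: complex_nonneg_Reals_iff)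
qed (fact fun_subspace_kernel_coeffs kernel_form_add_right kernel_form_scale_right
    kernel_form_hermitian[OF pos_def])+

lemma represents_iff:
  "kernel_represents S K u f \<longleftrightarrow>
     (\<forall>n. u n \<in> kernel_coeffs S) \<and> form_Cauchy (kernel_form K) u \<and>
     (\<forall>y\<in>S. (\<lambda>n. kernel_comb S K (u n) y) \<longlonglongrightarrow> f y) \<and> (\<forall>y. y \<notin> S \<longrightarrow> f y = 0)"
proof -
  define C where "C \<longleftrightarrow> (\<forall>e>0. \<exists>N. \<forall>m\<ge>N. \<forall>n\<ge>N.
        Re (kernel_form K (\<lambda>x. u m x - u n x) (\<lambda>x. u m x - u n x)) < e)"
  have Cauchy_iff: "C \<longleftrightarrow> form_Cauchy (kernel_form K) u" if "\<forall>n. u n \<in> kernel_coeffs S"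
  proof -
    have sq: "Re (kernel_form K (\<lambda>x. u m x - u n x) (\<lambda>x. u m x - u n x))
        = (coeffs.nrm (\<lambda>x. u m x - u n x))\<^sup>2" for m n
      using that by (simp add: coeffs.nrm_power2 coeffs.diff_mem)
    have nn: "0 \<le> coeffs.nrm (\<lambda>x. u m x - u n x)" for m n
      using that by (simp add: coeffs.nrm_nonneg coeffs.diff_mem)
    show ?thesis
    proof
      assume L: C
      show "form_Cauchy (kernel_form K) u" unfolding form_Cauchy_def
      proof (intro allI impI)
        fix e :: real assume e: "0 < e"
        then obtain N where "\<forall>m\<ge>N. \<forall>n\<ge>N. (coeffs.nrm (\<lambda>x. u m x - u n x))\<^sup>2 < e\<^sup>2"
          using L[unfolded C_def sq, rule_format, of "e\<^sup>2"] by auto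
        then show "\<exists>N. \<forall>m\<ge>N. \<forall>n\<ge>N. coeffs.nrm (\<lambda>x. u m x - u n x) < e"
          using power_less_imp_less_base[OF _ less_imp_le[OF e]] by blast
      qed
    next
      assume R: "form_Cauchy (kernel_form K) u"
      show C unfolding C_def sq
      proof (intro allI impI)
        fix e :: real assume e: "0 < e"
        then obtain N where "\<forall>m\<ge>N. \<forall>n\<ge>N. coeffs.nrm (\<lambda>x. u m x - u n x) < sqrt e"
          using R[unfolded form_Cauchy_def, rule_format, of "sqrt e"] by auto
        then have "\<forall>m\<ge>N. \<forall>n\<ge>N. (coeffs.nrm (\<lambda>x. u m x - u n x))\<^sup>2 < (sqrt e)\<^sup>2"
          using power_strict_mono[OF _ nn pos2] by blast
        then show "\<exists>N. \<forall>m\<ge>N. \<forall>n\<ge>N. (coeffs.nrm (\<lambda>x. u m x - u n x))\<^sup>2 < e"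
          using e by auto
      qed
    qed
  qed
  show ?thesis
    unfolding kernel_represents_def C_def[symmetric] using Cauchy_iff by blast
qed

lemma kernel_form_eq_comb:
  assumes "c \<in> kernel_coeffs S"
  shows "kernel_form K c d = (\<Sum>x | c x \<noteq> 0. cnj (c x) * kernel_comb S K d x)"
proof -
  have row: "(\<Sum>y | d y \<noteq> 0. cnj (c x) * d y * K x y) = cnj (c x) * kernel_comb S K d x"
    if "c x \<noteq> 0" for x
  proof -
    have "x \<in> S" using assms that by (auto simp: kernel_coeffs_def)
    then show ?thesis by (simp add: kernel_comb_def sum_distrib_left mult.assoc)
  qed
  show ?thesis unfolding kernel_form_def by (intro sum.cong refl row) simp
qed

lemma kernel_comb_add:
  assumes "c \<in> kernel_coeffs S" "d \<in> kernel_coeffs S" "y \<in> S"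
  shows "kernel_comb S K (\<lambda>x. c x + d x) y = kernel_comb S K c y + kernel_comb S K d y"
  unfolding kernel_comb_eq_form[OF assms(3)]
  using coeffs.add_right[OF delta_mem[OF assms(3)] assms(1,2)] .

lemma kernel_comb_scale:
  assumes "c \<in> kernel_coeffs S" "y \<in> S"
  shows "kernel_comb S K (\<lambda>x. a * c x) y = a * kernel_comb S K c y"
  unfolding kernel_comb_eq_form[OF assms(2)]
  using coeffs.scale_right[OF delta_mem[OF assms(2)] assms(1)] .

lemma kernel_comb_convergent:
  assumes u: "\<And>n. u n \<in> kernel_coeffs S" "form_Cauchy (kernel_form K) u" and y: "y \<in> S"
  shows "convergent (\<lambda>n. kernel_comb S K (u n) y)"
proof -
  have "form_Cauchy (kernel_form K) (\<lambda>n. delta y)"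
    using coeffs.nrm_zero by (simp add: form_Cauchy_def)
  then show ?thesis
    unfolding kernel_comb_eq_form[OF y]
    by (intro coeffs.form_Cauchy_convergent u delta_mem y)
qed

lemma Cauchy_represents:
  assumes "\<And>n. u n \<in> kernel_coeffs S" "form_Cauchy (kernel_form K) u"
  shows "\<exists>f. kernel_represents S K u f"
proof
  let ?f = "\<lambda>y. if y \<in> S then lim (\<lambda>n. kernel_comb S K (u n) y) else 0"
  have "(\<lambda>n. kernel_comb S K (u n) y) \<longlonglongrightarrow> ?f y" if "y \<in> S" for y
    using kernel_comb_convergent[OF assms that] that by (simp only: convergent_LIMSEQ_iff if_True)
  then show "kernel_represents S K u ?f" unfolding represents_iff using assms by simp
qed

lemma represents_add:
  assumes "kernel_represents S K u f" "kernel_represents S K v g"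
  shows "kernel_represents S K (\<lambda>n x. u n x + v n x) (\<lambda>x. f x + g x)"
proof -
  have u: "\<And>n. u n \<in> kernel_coeffs S" "form_Cauchy (kernel_form K) u"
    and v: "\<And>n. v n \<in> kernel_coeffs S" "form_Cauchy (kernel_form K) v"
    using assms unfolding represents_iff by auto
  have "form_Cauchy (kernel_form K) (\<lambda>n x. u n x + v n x)"
    unfolding form_Cauchy_def
  proof (intro allI impI)
    fix e :: real assume "0 < e"
    then have e: "0 < e / 2" by simp
    obtain N where N: "\<And>m n. m \<ge> N \<Longrightarrow> n \<ge> N \<Longrightarrow> coeffs.nrm (\<lambda>x. u m x - u n x) < e / 2"
      using u(2) e unfolding form_Cauchy_def by blast
    obtain N' where N': "\<And>m n. m \<ge> N' \<Longrightarrow> n \<ge> N' \<Longrightarrow> coeffs.nrm (\<lambda>x. v m x - v n x) < e / 2"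
      using v(2) e unfolding form_Cauchy_def by blast
    have "coeffs.nrm (\<lambda>x. u m x + v m x - (u n x + v n x)) < e"
      if "m \<ge> max N N'" "n \<ge> max N N'" for m n
    proof -
      have "coeffs.nrm (\<lambda>x. (u m x - u n x) + (v m x - v n x)) < e"
        using coeffs.nrm_triangle[OF coeffs.diff_mem[OF u(1) u(1)] coeffs.diff_mem[OF v(1) v(1)],
            of m n m n] N[of m n] N'[of m n] that by simp
      then show ?thesis by (simp add: algebra_simps)
    qed
    then show "\<exists>N. \<forall>m\<ge>N. \<forall>n\<ge>N. coeffs.nrm (\<lambda>x. u m x + v m x - (u n x + v n x)) < e"
      by blast
  qed
  then show ?thesis
    using assms by (auto simp: represents_iff kernel_comb_add coeffs.add_mem intro!: tendsto_add)
qed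

lemma represents_scale:
  assumes "kernel_represents S K u f"
  shows "kernel_represents S K (\<lambda>n x. a * u n x) (\<lambda>x. a * f x)"
proof -
  have u: "\<And>n. u n \<in> kernel_coeffs S" "form_Cauchy (kernel_form K) u"
    using assms unfolding represents_iff by auto
  have "form_Cauchy (kernel_form K) (\<lambda>n x. a * u n x)"
    unfolding form_Cauchy_def
  proof (intro allI impI)
    fix e :: real assume "0 < e"
    then have "0 < e / (cmod a + 1)" by (simp add: add_nonneg_pos)
    then obtain N where N: "\<And>m n. m \<ge> N \<Longrightarrow> n \<ge> N \<Longrightarrow>
        coeffs.nrm (\<lambda>x. u m x - u n x) < e / (cmod a + 1)"
      using u(2) unfolding form_Cauchy_def by blast
    have "coeffs.nrm (\<lambda>x. a * u m x - a * u n x) < e" if "m \<ge> N" "n \<ge> N" for m n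
    proof -
      have "coeffs.nrm (\<lambda>x. a * u m x - a * u n x) = cmod a * coeffs.nrm (\<lambda>x. u m x - u n x)"
        using coeffs.nrm_scale[OF coeffs.diff_mem[OF u(1) u(1)], of a m n]
        by (simp add: algebra_simps)
      also have "\<dots> \<le> (cmod a + 1) * coeffs.nrm (\<lambda>x. u m x - u n x)"
        using coeffs.nrm_nonneg[OF coeffs.diff_mem[OF u(1) u(1)]]
        by (intro mult_right_mono) auto
      also have "\<dots> < e"
        using N[OF that] by (simp add: pos_less_divide_eq add_nonneg_pos mult.commute)
      finally show ?thesis .
    qed
    then show "\<exists>N. \<forall>m\<ge>N. \<forall>n\<ge>N. coeffs.nrm (\<lambda>x. a * u m x - a * u n x) < e" by blast
  qed
  then show ?thesis
    using assms by (auto simp: represents_iff kernel_comb_scale coeffs.scale_mem intro!: tendsto_mult)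
qed

lemma represents_diff:
  assumes "kernel_represents S K u f" "kernel_represents S K v g"
  shows "kernel_represents S K (\<lambda>n x. u n x - v n x) (\<lambda>x. f x - g x)"
  using represents_add[OF assms(1) represents_scale[OF assms(2), of "-1"]] by simp

lemma represents_const:
  assumes "c \<in> kernel_coeffs S"
  shows "kernel_represents S K (\<lambda>_. c) (kernel_comb S K c)"
  using assms coeffs.nrm_zero by (simp add: represents_iff form_Cauchy_def kernel_comb_def)

text \<open>
  This is why the inner product does not depend on the representing sequences. Pointwise convergence
  to \<open>0\<close> gives \<open>\<langle>w\<^sub>N, w\<^sub>n\<rangle> \<rightarrow> 0\<close> for each fixed \<open>N\<close>, as \<open>w\<^sub>N\<close> is a finite combination of point masses, and
  \<open>\<parallel>w\<^sub>n\<parallel>\<^sup>2 = \<langle>w\<^sub>n - w\<^sub>N, w\<^sub>n\<rangle> + \<langle>w\<^sub>N, w\<^sub>n\<rangle>\<close>, where the Cauchy property bounds the first term.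
\<close>

lemma represents_zero_nrm:
  assumes "kernel_represents S K w (\<lambda>_. 0)"
  shows "(\<lambda>n. coeffs.nrm (w n)) \<longlonglongrightarrow> 0"
proof -
  have w: "\<And>n. w n \<in> kernel_coeffs S" and Cauchy: "form_Cauchy (kernel_form K) w"
    and lim: "\<And>y. y \<in> S \<Longrightarrow> (\<lambda>n. kernel_comb S K (w n) y) \<longlonglongrightarrow> 0"
    using assms unfolding represents_iff by auto
  obtain C where C: "0 < C" "\<And>n. coeffs.nrm (w n) \<le> C"
    using coeffs.form_Cauchy_nrm_bounded[OF w Cauchy] by blast
  have "(\<lambda>n. (coeffs.nrm (w n))\<^sup>2) \<longlonglongrightarrow> 0"
  proof (rule LIMSEQ_I)
    fix e :: real assume e: "0 < e"
    then have "0 < e / (2 * C)" using C(1) by simp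
    then obtain N where N: "\<And>m n. m \<ge> N \<Longrightarrow> n \<ge> N \<Longrightarrow>
        coeffs.nrm (\<lambda>x. w m x - w n x) < e / (2 * C)"
      using Cauchy unfolding form_Cauchy_def by blast
    have "(\<lambda>n. kernel_form K (w N) (w n)) \<longlonglongrightarrow> (\<Sum>x | w N x \<noteq> 0. cnj (w N x) * 0)"
      unfolding kernel_form_eq_comb[OF w]
      using w[of N] by (intro tendsto_sum tendsto_mult tendsto_const lim) (auto simp: kernel_coeffs_def)
    then have "(\<lambda>n. kernel_form K (w N) (w n)) \<longlonglongrightarrow> 0" by simp
    then obtain N' where N': "\<And>n. n \<ge> N' \<Longrightarrow> cmod (kernel_form K (w N) (w n)) < e / 2"
      using LIMSEQ_D[of "\<lambda>n. kernel_form K (w N) (w n)" 0 "e / 2"] e by auto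
    have "norm ((coeffs.nrm (w n))\<^sup>2 - 0) < e" if n: "n \<ge> max N N'" for n
    proof -
      have "(coeffs.nrm (w n))\<^sup>2 = Re (kernel_form K (\<lambda>x. w n x - w N x) (w n))
          + Re (kernel_form K (w N) (w n))"
        by (simp add: coeffs.nrm_power2 w coeffs.diff_left)
      also have "Re (kernel_form K (\<lambda>x. w n x - w N x) (w n))
          \<le> coeffs.nrm (\<lambda>x. w n x - w N x) * coeffs.nrm (w n)"
        by (intro coeffs.Re_Cauchy_Schwarz coeffs.diff_mem w)
      also have "\<dots> \<le> e / (2 * C) * C"
        using N[of n N] n C(2)[of n] C(1) e by (intro mult_mono coeffs.nrm_nonneg w) auto
      also have "\<dots> = e / 2" using C(1) by simp
      also have "Re (kernel_form K (w N) (w n)) < e / 2"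
        using N'[of n] n complex_Re_le_cmod[of "kernel_form K (w N) (w n)"] by simp
      finally show ?thesis by simp
    qed
    then show "\<exists>no. \<forall>n\<ge>no. norm ((coeffs.nrm (w n))\<^sup>2 - 0) < e" by blast
  qed
  then have "(\<lambda>n. sqrt ((coeffs.nrm (w n))\<^sup>2)) \<longlonglongrightarrow> sqrt 0" by (rule tendsto_real_sqrt)
  then show ?thesis using coeffs.nrm_nonneg w by simp
qed

text \<open>
  The definite description in the inner product is meaningful: the forms along any two pairs of
  representing sequences differ by a null sequence.
\<close>

lemma represents_form_tendsto:
  assumes f: "kernel_represents S K u f" and g: "kernel_represents S K v g"
  shows "(\<lambda>n. kernel_form K (u n) (v n)) \<longlonglongrightarrow> rkhs_inner S K f g"
proof -
  have coeff: "\<And>n. u n \<in> kernel_coeffs S" "form_Cauchy (kernel_form K) u"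
    if "kernel_represents S K u f" for u f
    using that unfolding represents_iff by auto
  obtain z where z: "(\<lambda>n. kernel_form K (u n) (v n)) \<longlonglongrightarrow> z"
    using coeffs.form_Cauchy_convergent[OF coeff[OF f] coeff[OF g]] by (auto simp: convergent_def)
  have all: "(\<lambda>n. kernel_form K (u' n) (v' n)) \<longlonglongrightarrow> z"
    if f': "kernel_represents S K u' f" and g': "kernel_represents S K v' g" for u' v'
  proof -
    note mem = coeff(1)[OF f] coeff(1)[OF g] coeff(1)[OF f'] coeff(1)[OF g']
    obtain C where C: "0 < C" "\<And>n. coeffs.nrm (v' n) \<le> C"
      using coeffs.form_Cauchy_nrm_bounded[OF coeff[OF g']] by blast
    obtain E where E: "0 < E" "\<And>n. coeffs.nrm (u n) \<le> E"
      using coeffs.form_Cauchy_nrm_bounded[OF coeff[OF f]] by blast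
    have "(\<lambda>n. coeffs.nrm (\<lambda>x. u' n x - u n x)) \<longlonglongrightarrow> 0"
      using represents_zero_nrm represents_diff[OF f' f] by simp
    moreover have "(\<lambda>n. coeffs.nrm (\<lambda>x. v' n x - v n x)) \<longlonglongrightarrow> 0"
      using represents_zero_nrm represents_diff[OF g' g] by simp
    ultimately have "(\<lambda>n. coeffs.nrm (\<lambda>x. u' n x - u n x) * C + E * coeffs.nrm (\<lambda>x. v' n x - v n x))
        \<longlonglongrightarrow> 0 * C + E * 0"
      by (intro tendsto_intros)
    then have lim: "(\<lambda>n. coeffs.nrm (\<lambda>x. u' n x - u n x) * C
        + E * coeffs.nrm (\<lambda>x. v' n x - v n x)) \<longlonglongrightarrow> 0" by simp
    have bound: "cmod (kernel_form K (u' n) (v' n) - kernel_form K (u n) (v n))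
        \<le> coeffs.nrm (\<lambda>x. u' n x - u n x) * C + E * coeffs.nrm (\<lambda>x. v' n x - v n x)" for n
    proof -
      have "cmod (kernel_form K (u' n) (v' n) - kernel_form K (u n) (v n))
          \<le> coeffs.nrm (\<lambda>x. u' n x - u n x) * coeffs.nrm (v' n)
            + coeffs.nrm (u n) * coeffs.nrm (\<lambda>x. v' n x - v n x)"
        by (intro coeffs.form_diff_bound mem)
      also have "\<dots> \<le> coeffs.nrm (\<lambda>x. u' n x - u n x) * C
            + E * coeffs.nrm (\<lambda>x. v' n x - v n x)"
        using C E by (intro add_mono mult_mono coeffs.nrm_nonneg coeffs.diff_mem mem) auto
      finally show ?thesis .
    qed
    have "(\<lambda>n. kernel_form K (u' n) (v' n) - kernel_form K (u n) (v n)) \<longlonglongrightarrow> 0"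
      by (rule Lim_null_comparison[OF always_eventually lim]) (intro allI bound)
    from tendsto_add[OF this z] show ?thesis by simp
  qed
  have "rkhs_inner S K f g = z"
    unfolding rkhs_inner_def
  proof (rule the_equality)
    show "\<forall>u v. kernel_represents S K u f \<longrightarrow> kernel_represents S K v g \<longrightarrow>
        (\<lambda>n. kernel_form K (u n) (v n)) \<longlonglongrightarrow> z" using all by blast
    fix w assume "\<forall>u v. kernel_represents S K u f \<longrightarrow> kernel_represents S K v g \<longrightarrow>
        (\<lambda>n. kernel_form K (u n) (v n)) \<longlonglongrightarrow> w"
    then show "w = z" using f g z LIMSEQ_unique by blast
  qed
  then show ?thesis using z by simp
qed

sublocale H: psd_form "rkhs S K" "rkhs_inner S K"
proof
  show "fun_subspace (rkhs S K)"
    unfolding fun_subspace_def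
  proof (intro conjI ballI allI)
    have "kernel_comb S K (\<lambda>_. 0) = (\<lambda>_. 0)" by (simp add: kernel_comb_def fun_eq_iff)
    then show "(\<lambda>_. 0) \<in> rkhs S K"
      using represents_const[OF coeffs.zero_mem] unfolding rkhs_def by auto
    show "(\<lambda>x. f x + g x) \<in> rkhs S K" if "f \<in> rkhs S K" "g \<in> rkhs S K" for f g
      using that represents_add unfolding rkhs_def by blast
    show "(\<lambda>x. c * f x) \<in> rkhs S K" if "f \<in> rkhs S K" for c f
      using that represents_scale unfolding rkhs_def by blast
  qed
next
  fix u v w assume "u \<in> rkhs S K" "v \<in> rkhs S K" "w \<in> rkhs S K"
  then obtain p q r where *: "kernel_represents S K p u" "kernel_represents S K q v"
    "kernel_represents S K r w" by (auto simp: rkhs_def)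
  have "(\<lambda>n. kernel_form K (p n) (\<lambda>x. q n x + r n x)) \<longlonglongrightarrow> rkhs_inner S K u (\<lambda>x. v x + w x)"
    using * by (intro represents_form_tendsto represents_add)
  moreover have "(\<lambda>n. kernel_form K (p n) (\<lambda>x. q n x + r n x))
      = (\<lambda>n. kernel_form K (p n) (q n) + kernel_form K (p n) (r n))"
    using * by (simp add: represents_iff coeffs.add_right)
  moreover have "(\<lambda>n. kernel_form K (p n) (q n) + kernel_form K (p n) (r n))
      \<longlonglongrightarrow> rkhs_inner S K u v + rkhs_inner S K u w"
    using * by (intro tendsto_add represents_form_tendsto)
  ultimately show "rkhs_inner S K u (\<lambda>x. v x + w x) = rkhs_inner S K u v + rkhs_inner S K u w"
    using LIMSEQ_unique by metis
next
  fix u v c assume "u \<in> rkhs S K" "v \<in> rkhs S K"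
  then obtain p q where *: "kernel_represents S K p u" "kernel_represents S K q v"
    by (auto simp: rkhs_def)
  have "(\<lambda>n. kernel_form K (p n) (\<lambda>x. c * q n x)) \<longlonglongrightarrow> rkhs_inner S K u (\<lambda>x. c * v x)"
    using * by (intro represents_form_tendsto represents_scale)
  moreover have "(\<lambda>n. kernel_form K (p n) (\<lambda>x. c * q n x)) = (\<lambda>n. c * kernel_form K (p n) (q n))"
    using * by (simp add: represents_iff coeffs.scale_right)
  moreover have "(\<lambda>n. c * kernel_form K (p n) (q n)) \<longlonglongrightarrow> c * rkhs_inner S K u v"
    using * by (intro tendsto_mult tendsto_const represents_form_tendsto)
  ultimately show "rkhs_inner S K u (\<lambda>x. c * v x) = c * rkhs_inner S K u v"
    using LIMSEQ_unique by metis
next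
  fix u v assume "u \<in> rkhs S K" "v \<in> rkhs S K"
  then obtain p q where *: "kernel_represents S K p u" "kernel_represents S K q v"
    by (auto simp: rkhs_def)
  have "(\<lambda>n. cnj (kernel_form K (p n) (q n))) \<longlonglongrightarrow> cnj (rkhs_inner S K u v)"
    using * by (intro tendsto_cnj represents_form_tendsto)
  moreover have "(\<lambda>n. cnj (kernel_form K (p n) (q n))) = (\<lambda>n. kernel_form K (q n) (p n))"
  proof
    show "cnj (kernel_form K (p n) (q n)) = kernel_form K (q n) (p n)" for n
      using * coeffs.herm[of "p n" "q n"] by (simp add: represents_iff)
  qed
  moreover have "(\<lambda>n. kernel_form K (q n) (p n)) \<longlonglongrightarrow> rkhs_inner S K v u"
    using * by (intro represents_form_tendsto)
  ultimately show "rkhs_inner S K v u = cnj (rkhs_inner S K u v)"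
    using LIMSEQ_unique by metis
next
  fix u assume "u \<in> rkhs S K"
  then obtain p where *: "kernel_represents S K p u" by (auto simp: rkhs_def)
  have "(\<lambda>n. Re (kernel_form K (p n) (p n))) \<longlonglongrightarrow> Re (rkhs_inner S K u u)"
    using * by (intro tendsto_Re represents_form_tendsto)
  then show "0 \<le> Re (rkhs_inner S K u u)"
    using * by (elim LIMSEQ_le_const) (auto simp: represents_iff intro: coeffs.Re_nonneg)
qed

lemma rkhs_norm_eq: "rkhs_norm S K = H.nrm"
  by (simp add: fun_eq_iff rkhs_norm_def form_norm_def)

lemma kernel_comb_mem: "c \<in> kernel_coeffs S \<Longrightarrow> kernel_comb S K c \<in> rkhs S K"
  using represents_const unfolding rkhs_def by blast

lemma reproducing:
  assumes f: "f \<in> rkhs S K" and y: "y \<in> S"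
  shows "f y = rkhs_inner S K (kernel_comb S K (delta y)) f"
proof -
  obtain u where u: "kernel_represents S K u f" using f by (auto simp: rkhs_def)
  have "(\<lambda>n. kernel_comb S K (u n) y) \<longlonglongrightarrow> rkhs_inner S K (kernel_comb S K (delta y)) f"
    unfolding kernel_comb_eq_form[OF y]
    by (intro represents_form_tendsto represents_const delta_mem y u)
  moreover have "(\<lambda>n. kernel_comb S K (u n) y) \<longlonglongrightarrow> f y"
    using u y by (simp add: represents_iff)
  ultimately show ?thesis using LIMSEQ_unique by blast
qed

text \<open>
  The Cauchy-Schwarz inequality against the kernel section at \<open>y\<close>. Every passage from norm limits to
  pointwise limits rests on this bound.
\<close>

lemma eval_bound:
  assumes "f \<in> rkhs S K" "y \<in> S"
  shows "cmod (f y) \<le> H.nrm (kernel_comb S K (delta y)) * H.nrm f"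
  using assms H.Cauchy_Schwarz[OF kernel_comb_mem[OF delta_mem]] by (simp add: reproducing)

lemma rkhs_outside: "f \<in> rkhs S K \<Longrightarrow> y \<notin> S \<Longrightarrow> f y = 0"
  by (auto simp: rkhs_def represents_iff)

lemma norm_zero_imp_zero:
  assumes "f \<in> rkhs S K" "H.nrm f = 0"
  shows "f = (\<lambda>_. 0)"
proof
  show "f y = 0" for y
    using eval_bound[OF assms(1), of y] rkhs_outside[OF assms(1), of y] assms(2)
    by (cases "y \<in> S") auto
qed

lemma eq_if_dist_zero:
  assumes "f \<in> rkhs S K" "g \<in> rkhs S K" "H.nrm (\<lambda>x. f x - g x) = 0"
  shows "f = g"
  using norm_zero_imp_zero[OF H.diff_mem[OF assms(1,2)] assms(3)] by (simp add: fun_eq_iff)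

lemma norm_tendsto_imp_pointwise:
  assumes "\<And>n. s n \<in> rkhs S K" "f \<in> rkhs S K" "(\<lambda>n. H.nrm (\<lambda>x. s n x - f x)) \<longlonglongrightarrow> 0"
  shows "(\<lambda>n. s n y) \<longlonglongrightarrow> f y"
proof (cases "y \<in> S")
  case True
  have "(\<lambda>n. s n y - f y) \<longlonglongrightarrow> 0"
  proof (rule Lim_null_comparison[OF always_eventually tendsto_mult_right_zero[OF assms(3)]])
    show "\<forall>n. norm (s n y - f y) \<le> H.nrm (kernel_comb S K (delta y)) * H.nrm (\<lambda>x. s n x - f x)"
      using eval_bound[OF H.diff_mem[OF assms(1,2)] True] by simp
  qed
  then show ?thesis by (simp only: LIM_zero_iff)
next
  case False
  then show ?thesis by (simp add: rkhs_outside[OF assms(1)] rkhs_outside[OF assms(2)])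
qed

lemma represents_imp_norm_tendsto:
  assumes u: "kernel_represents S K u f"
  shows "(\<lambda>n. H.nrm (\<lambda>x. kernel_comb S K (u n) x - f x)) \<longlonglongrightarrow> 0"
proof (rule LIMSEQ_I)
  fix e :: real assume "0 < e"
  then have e: "0 < e / 2" by simp
  have mem: "\<And>n. u n \<in> kernel_coeffs S" and "form_Cauchy (kernel_form K) u"
    using u by (auto simp: represents_iff)
  then obtain N where N: "\<And>m n. m \<ge> N \<Longrightarrow> n \<ge> N \<Longrightarrow> coeffs.nrm (\<lambda>x. u m x - u n x) < e / 2"
    using e unfolding form_Cauchy_def by blast
  have "norm (H.nrm (\<lambda>x. kernel_comb S K (u n) x - f x) - 0) < e" if n: "n \<ge> N" for n
  proof -
    let ?d = "\<lambda>x. kernel_comb S K (u n) x - f x"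
    have rep: "kernel_represents S K (\<lambda>m x. u n x - u m x) ?d"
      using represents_diff[OF represents_const[OF mem] u] .
    have "(\<lambda>m. coeffs.nrm (\<lambda>x. u n x - u m x)) \<longlonglongrightarrow> H.nrm ?d"
      unfolding form_norm_def
      by (intro tendsto_real_sqrt tendsto_Re represents_form_tendsto rep)
    then have "H.nrm ?d \<le> e / 2"
      by (rule LIMSEQ_le_const2) (use N n in \<open>auto intro!: exI[of _ N] less_imp_le\<close>)
    moreover have "?d \<in> rkhs S K" using rep by (auto simp: rkhs_def)
    ultimately show ?thesis using e H.nrm_nonneg by simp
  qed
  then show "\<exists>no. \<forall>n\<ge>no. norm (H.nrm (\<lambda>x. kernel_comb S K (u n) x - f x) - 0) < e" by blast
qed

lemma nrm_kernel_comb: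
  assumes "c \<in> kernel_coeffs S"
  shows "H.nrm (kernel_comb S K c) = coeffs.nrm c"
proof -
  have "(\<lambda>_::nat. kernel_form K c c) \<longlonglongrightarrow> rkhs_inner S K (kernel_comb S K c) (kernel_comb S K c)"
    using represents_form_tendsto represents_const[OF assms] by blast
  then show ?thesis unfolding form_norm_def by (simp add: LIMSEQ_const_iff)
qed

lemma kernel_comb_diff:
  assumes "c \<in> kernel_coeffs S" "d \<in> kernel_coeffs S"
  shows "kernel_comb S K (\<lambda>x. c x - d x) = (\<lambda>x. kernel_comb S K c x - kernel_comb S K d x)"
proof
  show "kernel_comb S K (\<lambda>x. c x - d x) y = kernel_comb S K c y - kernel_comb S K d y" for y
    using assms coeffs.diff_right[OF delta_mem assms, of y]
    by (cases "y \<in> S") (simp add: kernel_comb_eq_form, simp add: kernel_comb_def)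
qed

text \<open>
  Approximating each \<open>s\<^sub>n\<close> by a finite kernel combination to within \<open>1 / (n + 1)\<close> gives a Cauchy sequence
  of coefficients, and the function it represents is the limit.
\<close>

theorem rkhs_complete:
  assumes s: "\<And>n. s n \<in> rkhs S K" and Cauchy: "form_Cauchy (rkhs_inner S K) s"
  shows "\<exists>f\<in>rkhs S K. (\<lambda>n. H.nrm (\<lambda>x. s n x - f x)) \<longlonglongrightarrow> 0"
proof -
  have "\<exists>c\<in>kernel_coeffs S. H.nrm (\<lambda>x. kernel_comb S K c x - s n x) < inverse (real (Suc n))" for n
  proof -
    obtain u where u: "kernel_represents S K u (s n)" using s[of n] by (auto simp: rkhs_def)
    obtain k where "norm (H.nrm (\<lambda>x. kernel_comb S K (u k) x - s n x) - 0) < inverse (real (Suc n))"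
      using LIMSEQ_D[OF represents_imp_norm_tendsto[OF u], of "inverse (real (Suc n))"] by auto
    moreover have "u k \<in> kernel_coeffs S" using u by (simp add: represents_iff)
    ultimately show ?thesis by (intro bexI[of _ "u k"]) auto
  qed
  then obtain c where c: "\<And>n. c n \<in> kernel_coeffs S"
    and approx: "\<And>n. H.nrm (\<lambda>x. kernel_comb S K (c n) x - s n x) < inverse (real (Suc n))"
    by metis
  let ?k = "\<lambda>n. kernel_comb S K (c n)"
  have k: "?k n \<in> rkhs S K" for n using c by (rule kernel_comb_mem)
  have "form_Cauchy (kernel_form K) c"
    unfolding form_Cauchy_def
  proof (intro allI impI)
    fix e :: real assume "0 < e"
    then have e: "0 < e / 3" by simp
    obtain N where N: "\<And>m n. m \<ge> N \<Longrightarrow> n \<ge> N \<Longrightarrow> H.nrm (\<lambda>x. s m x - s n x) < e / 3"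
      using Cauchy e unfolding form_Cauchy_def by blast
    obtain N' where N': "inverse (real (Suc N')) < e / 3" using reals_Archimedean[OF e] by blast
    have small: "H.nrm (\<lambda>x. ?k n x - s n x) < e / 3" if "n \<ge> N'" for n
    proof -
      have "inverse (real (Suc n)) \<le> inverse (real (Suc N'))" using that by simp
      then show ?thesis using approx[of n] N' by linarith
    qed
    have "coeffs.nrm (\<lambda>x. c m x - c n x) < e" if mn: "m \<ge> max N N'" "n \<ge> max N N'" for m n
    proof -
      have "coeffs.nrm (\<lambda>x. c m x - c n x) = H.nrm (\<lambda>x. ?k m x - ?k n x)"
        using nrm_kernel_comb[OF coeffs.diff_mem[OF c c], of m n] kernel_comb_diff[OF c c, of m n]
        by simp
      also have "\<dots> \<le> H.nrm (\<lambda>x. ?k m x - s m x) + H.nrm (\<lambda>x. s m x - ?k n x)"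
        by (rule H.nrm_diff_triangle[OF k s k])
      also have "H.nrm (\<lambda>x. s m x - ?k n x) \<le> H.nrm (\<lambda>x. s m x - s n x) + H.nrm (\<lambda>x. s n x - ?k n x)"
        by (rule H.nrm_diff_triangle[OF s s k])
      also have "H.nrm (\<lambda>x. s n x - ?k n x) = H.nrm (\<lambda>x. ?k n x - s n x)"
        by (rule H.nrm_minus_commute[OF s k])
      finally show ?thesis using N[of m n] small[of m] small[of n] mn by simp
    qed
    then show "\<exists>N. \<forall>m\<ge>N. \<forall>n\<ge>N. coeffs.nrm (\<lambda>x. c m x - c n x) < e" by blast
  qed
  then obtain f where f: "kernel_represents S K c f" using Cauchy_represents c by blast
  then have fH: "f \<in> rkhs S K" by (auto simp: rkhs_def)
  have "(\<lambda>n. H.nrm (\<lambda>x. s n x - f x)) \<longlonglongrightarrow> 0"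
  proof (rule Lim_null_comparison)
    have "(\<lambda>n. inverse (real (Suc n)) + H.nrm (\<lambda>x. ?k n x - f x)) \<longlonglongrightarrow> 0 + 0"
      by (intro tendsto_add LIMSEQ_inverse_real_of_nat represents_imp_norm_tendsto f)
    then show "(\<lambda>n. inverse (real (Suc n)) + H.nrm (\<lambda>x. ?k n x - f x)) \<longlonglongrightarrow> 0" by simp
    show "\<forall>\<^sub>F n in sequentially. norm (H.nrm (\<lambda>x. s n x - f x))
        \<le> inverse (real (Suc n)) + H.nrm (\<lambda>x. ?k n x - f x)"
    proof (intro always_eventually allI)
      fix n
      have "H.nrm (\<lambda>x. s n x - f x) \<le> H.nrm (\<lambda>x. s n x - ?k n x) + H.nrm (\<lambda>x. ?k n x - f x)"
        by (rule H.nrm_diff_triangle[OF s k fH])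
      then show "norm (H.nrm (\<lambda>x. s n x - f x))
          \<le> inverse (real (Suc n)) + H.nrm (\<lambda>x. ?k n x - f x)"
        using approx[of n] H.nrm_minus_commute[OF s k, of n n] H.nrm_nonneg[OF H.diff_mem[OF s fH]]
        by simp
    qed
  qed
  then show ?thesis using fH by blast
qed

end

section \<open>Square-integrable functions\<close>

lemma L2_measurable: "g \<in> L2 M \<Longrightarrow> g \<in> borel_measurable M"
  and L2_integrable: "g \<in> L2 M \<Longrightarrow> integrable M (\<lambda>x. (cmod (g x))\<^sup>2)"
  by (simp_all add: L2_def)

lemma fun_subspace_L2: "fun_subspace (L2 M)"
  unfolding fun_subspace_def
proof (intro conjI ballI allI)
  show "(\<lambda>_. 0) \<in> L2 M" by (simp add: L2_def)
  fix f g assume f: "f \<in> L2 M"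
  note [measurable] = L2_measurable[OF f]
  show "(\<lambda>x. c * f x) \<in> L2 M" for c
    using L2_integrable[OF f] by (simp add: L2_def norm_mult power_mult_distrib)
  assume g: "g \<in> L2 M"
  note [measurable] = L2_measurable[OF g]
  have "integrable M (\<lambda>x. 2 * (cmod (f x))\<^sup>2 + 2 * (cmod (g x))\<^sup>2)"
    using L2_integrable[OF f] L2_integrable[OF g] by simp
  moreover have "(cmod (f x + g x))\<^sup>2 \<le> 2 * (cmod (f x))\<^sup>2 + 2 * (cmod (g x))\<^sup>2" for x
  proof -
    have "(cmod (f x + g x))\<^sup>2 \<le> (cmod (f x) + cmod (g x))\<^sup>2"
      by (intro power_mono norm_triangle_ineq) simp
    also have "\<dots> \<le> 2 * (cmod (f x))\<^sup>2 + 2 * (cmod (g x))\<^sup>2"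
      using sum_squares_bound[of "cmod (f x)" "cmod (g x)"] by (simp add: power2_sum)
    finally show ?thesis .
  qed
  ultimately have "integrable M (\<lambda>x. (cmod (f x + g x))\<^sup>2)"
    by (elim Bochner_Integration.integrable_bound) auto
  then show "(\<lambda>x. f x + g x) \<in> L2 M" by (simp add: L2_def)
qed

lemma L2_product_integrable:
  assumes g: "g \<in> L2 M" and h: "h \<in> L2 M"
  shows "integrable M (\<lambda>x. cnj (g x) * h x)"
proof -
  note [measurable] = L2_measurable[OF g] L2_measurable[OF h]
  have "integrable M (\<lambda>x. (cmod (g x))\<^sup>2 + (cmod (h x))\<^sup>2)"
    using L2_integrable[OF g] L2_integrable[OF h] by simp
  moreover have "cmod (cnj (g x) * h x) \<le> (cmod (g x))\<^sup>2 + (cmod (h x))\<^sup>2" for x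
  proof -
    have "2 * (cmod (g x) * cmod (h x)) \<le> (cmod (g x))\<^sup>2 + (cmod (h x))\<^sup>2"
      using sum_squares_bound[of "cmod (g x)" "cmod (h x)"] by simp
    moreover have "0 \<le> cmod (g x) * cmod (h x)" by simp
    ultimately show ?thesis unfolding norm_mult complex_mod_cnj by linarith
  qed
  moreover have "(\<lambda>x. cnj (g x)) \<in> borel_measurable M"
    by (rule borel_measurable_continuous_on[of cnj])
       (auto intro: continuous_intros L2_measurable[OF g])
  ultimately show ?thesis by (elim Bochner_Integration.integrable_bound) auto
qed

lemma L2_inner_self: "L2_inner M g g = of_real (\<integral>x. (cmod (g x))\<^sup>2 \<partial>M)"
proof -
  have "cnj (g x) * g x = of_real ((cmod (g x))\<^sup>2)" for x
    by (metis complex_norm_square mult.commute)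
  then show ?thesis unfolding L2_inner_def by (simp only: integral_complex_of_real)
qed

lemma L2_norm_eq: "L2_norm M = form_norm (L2_inner M)"
  by (simp add: fun_eq_iff L2_norm_def form_norm_def L2_inner_self)

lemma psd_form_L2: "psd_form (L2 M) (L2_inner M)"
proof
  show "fun_subspace (L2 M)" by (rule fun_subspace_L2)
next
  fix u v w assume u: "u \<in> L2 M" and v: "v \<in> L2 M" and w: "w \<in> L2 M"
  show "L2_inner M u (\<lambda>x. v x + w x) = L2_inner M u v + L2_inner M u w"
    unfolding L2_inner_def distrib_left
    by (intro Bochner_Integration.integral_add L2_product_integrable u v w)
next
  fix u v c
  show "L2_inner M u (\<lambda>x. c * v x) = c * L2_inner M u v"
    unfolding L2_inner_def by (simp add: mult.left_commute[of _ c])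
  show "L2_inner M v u = cnj (L2_inner M u v)"
  proof -
    have "cnj (L2_inner M u v) = (\<integral>x. cnj (cnj (u x) * v x) \<partial>M)"
      unfolding L2_inner_def by (rule Bochner_Integration.integral_cnj[symmetric])
    also have "\<dots> = L2_inner M v u"
      unfolding L2_inner_def by (rule arg_cong[where f = "integral\<^sup>L M"]) (simp add: fun_eq_iff)
    finally show ?thesis by simp
  qed
  show "0 \<le> Re (L2_inner M u u)" by (simp add: L2_inner_self)
qed

lemma L2_inner_cong_AE:
  assumes "g \<in> L2 M" "g' \<in> L2 M" "h \<in> L2 M" "AE x in M. g x = g' x"
  shows "L2_inner M g h = L2_inner M g' h"
  unfolding L2_inner_def
proof (rule integral_cong_AE)
  show "AE x in M. cnj (g x) * h x = cnj (g' x) * h x" using assms(4) by eventually_elim simp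
qed (use assms(1-3) in \<open>auto intro: borel_measurable_integrable L2_product_integrable\<close>)

lemma L2_norm_cong_AE:
  assumes "g \<in> L2 M" "g' \<in> L2 M" "AE x in M. g x = g' x"
  shows "L2_norm M g = L2_norm M g'"
  unfolding L2_norm_def
proof (rule arg_cong[where f = sqrt], rule integral_cong_AE)
  show "AE x in M. (cmod (g x))\<^sup>2 = (cmod (g' x))\<^sup>2" using assms(3) by eventually_elim simp
qed (use assms(1,2) in \<open>auto intro: borel_measurable_integrable L2_integrable\<close>)

lemma L2_norm_eq_0_imp_AE:
  assumes "g \<in> L2 M" "L2_norm M g = 0"
  shows "AE x in M. g x = 0"
proof -
  have "(\<integral>x. (cmod (g x))\<^sup>2 \<partial>M) = 0" using assms(2) by (simp add: L2_norm_def)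
  then have "AE x in M. (cmod (g x))\<^sup>2 = 0"
    using integral_nonneg_eq_0_iff_AE[OF L2_integrable[OF assms(1)]] by simp
  then show ?thesis by simp
qed

text \<open>
  Fatou's lemma gives \<open>\<parallel>s\<^sub>n - f\<parallel> \<le> liminf\<^sub>m \<parallel>s\<^sub>n - s\<^sub>m\<parallel>\<close>, and the right-hand side is small for large \<open>n\<close>.
\<close>

lemma L2_Cauchy_pointwise:
  assumes s: "\<And>n. s n \<in> L2 M" and Cauchy: "form_Cauchy (L2_inner M) s"
    and lim: "\<And>x. x \<in> space M \<Longrightarrow> (\<lambda>n. s n x) \<longlonglongrightarrow> f x"
  shows "f \<in> L2 M" and "(\<lambda>n. L2_norm M (\<lambda>x. s n x - f x)) \<longlonglongrightarrow> 0"
proof -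
  interpret psd_form "L2 M" "L2_inner M" by (rule psd_form_L2)
  note [measurable] = L2_measurable[OF s]
  have [measurable]: "f \<in> borel_measurable M"
    using lim by (rule borel_measurable_LIMSEQ_metric[rotated]) measurable
  have nn: "(\<integral>\<^sup>+x. ennreal ((cmod (g x))\<^sup>2) \<partial>M) = ennreal ((L2_norm M g)\<^sup>2)" if "g \<in> L2 M" for g
    using L2_integrable[OF that] by (simp add: L2_norm_def nn_integral_eq_integral)
  have bound: "(\<integral>\<^sup>+x. ennreal ((cmod (s n x - f x))\<^sup>2) \<partial>M) \<le> ennreal (e\<^sup>2)"
    if e: "0 < e" and N: "\<And>m n. m \<ge> N \<Longrightarrow> n \<ge> N \<Longrightarrow> nrm (\<lambda>x. s m x - s n x) < e" and n: "n \<ge> N"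
    for n N e
  proof -
    have "(\<integral>\<^sup>+x. ennreal ((cmod (s n x - f x))\<^sup>2) \<partial>M)
        = (\<integral>\<^sup>+x. liminf (\<lambda>m. ennreal ((cmod (s n x - s m x))\<^sup>2)) \<partial>M)"
    proof (rule nn_integral_cong)
      fix x assume "x \<in> space M"
      then have "(\<lambda>m. ennreal ((cmod (s n x - s m x))\<^sup>2)) \<longlonglongrightarrow> ennreal ((cmod (s n x - f x))\<^sup>2)"
        using lim by (intro tendsto_intros)
      then show "ennreal ((cmod (s n x - f x))\<^sup>2) = liminf (\<lambda>m. ennreal ((cmod (s n x - s m x))\<^sup>2))"
        by (intro lim_imp_Liminf[symmetric] trivial_limit_sequentially)
    qed
    also have "\<dots> \<le> liminf (\<lambda>m. \<integral>\<^sup>+x. ennreal ((cmod (s n x - s m x))\<^sup>2) \<partial>M)"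
      by (rule nn_integral_liminf) measurable
    also have "\<dots> \<le> ennreal (e\<^sup>2)"
    proof (rule Liminf_le)
      show "\<forall>\<^sub>F m in sequentially. (\<integral>\<^sup>+x. ennreal ((cmod (s n x - s m x))\<^sup>2) \<partial>M) \<le> ennreal (e\<^sup>2)"
        using eventually_ge_at_top[of N]
      proof eventually_elim
        case (elim m)
        have "nrm (\<lambda>x. s n x - s m x) \<le> e" using N[OF n elim] by simp
        then have "(nrm (\<lambda>x. s n x - s m x))\<^sup>2 \<le> e\<^sup>2"
          using nrm_nonneg[OF diff_mem[OF s s]] by (intro power_mono)
        then show ?case by (simp add: nn[OF diff_mem[OF s s]] L2_norm_eq ennreal_leI)
      qed
    qed simp
    finally show ?thesis .
  qed
  have close: "(\<lambda>x. s n x - f x) \<in> L2 M \<and> L2_norm M (\<lambda>x. s n x - f x) \<le> e"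
    if e: "0 < e" and N: "\<And>m n. m \<ge> N \<Longrightarrow> n \<ge> N \<Longrightarrow> nrm (\<lambda>x. s m x - s n x) < e" and n: "n \<ge> N"
    for n N e
  proof
    have "(\<integral>\<^sup>+x. ennreal (norm ((cmod (s n x - f x))\<^sup>2)) \<partial>M) < \<infinity>"
      using bound[OF that] by (auto intro: le_less_trans)
    then have "integrable M (\<lambda>x. (cmod (s n x - f x))\<^sup>2)"
      by (intro integrableI_bounded) measurable
    then show mem: "(\<lambda>x. s n x - f x) \<in> L2 M" by (simp add: L2_def)
    have "(L2_norm M (\<lambda>x. s n x - f x))\<^sup>2 \<le> e\<^sup>2"
      using bound[OF that] nn[OF mem] by simp
    then show "L2_norm M (\<lambda>x. s n x - f x) \<le> e" by (rule power2_le_imp_le[OF _ less_imp_le[OF e]])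
  qed
  obtain N where "\<And>m n. m \<ge> N \<Longrightarrow> n \<ge> N \<Longrightarrow> nrm (\<lambda>x. s m x - s n x) < 1"
    using Cauchy unfolding form_Cauchy_def using zero_less_one by blast
  then have "(\<lambda>x. s N x - f x) \<in> L2 M" by (rule close[OF zero_less_one _ order_refl, THEN conjunct1])
  from diff_mem[OF s[of N] this] show f: "f \<in> L2 M" by simp
  show "(\<lambda>n. L2_norm M (\<lambda>x. s n x - f x)) \<longlonglongrightarrow> 0"
  proof (rule LIMSEQ_I)
    fix e :: real assume e: "0 < e"
    then have "0 < e / 2" by simp
    then obtain N where N: "\<And>m n. m \<ge> N \<Longrightarrow> n \<ge> N \<Longrightarrow> nrm (\<lambda>x. s m x - s n x) < e / 2"
      using Cauchy unfolding form_Cauchy_def by blast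
    have "norm (L2_norm M (\<lambda>x. s n x - f x) - 0) < e" if "n \<ge> N" for n
      using close[OF \<open>0 < e / 2\<close> N that] nrm_nonneg[OF diff_mem[OF s f], of n] e
      by (simp add: L2_norm_eq)
    then show "\<exists>no. \<forall>n\<ge>no. norm (L2_norm M (\<lambda>x. s n x - f x) - 0) < e" by blast
  qed
qed

section \<open>The closure of the evaluation operator and its adjoint\<close>

locale evaluation_operator = pd_kernel "space M" K
  for M :: "'a measure" and K :: "'a \<Rightarrow> 'a \<Rightarrow> complex" +
  fixes D :: "('a \<Rightarrow> complex) set"
  assumes D_subspace: "fun_subspace D"
    and D_rkhs: "D \<subseteq> rkhs (space M) K"
    and D_L2: "D \<subseteq> L2 M"
begin

sublocale L2: psd_form "L2 M" "L2_inner M"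
  by (rule psd_form_L2)

abbreviation T :: "(('a \<Rightarrow> complex) \<times> ('a \<Rightarrow> complex)) set" where
  "T \<equiv> eval_op M D"

abbreviation \<H> :: "('a \<Rightarrow> complex) set" where
  "\<H> \<equiv> rkhs (space M) K"

abbreviation inner_H :: "('a \<Rightarrow> complex) \<Rightarrow> ('a \<Rightarrow> complex) \<Rightarrow> complex" where
  "inner_H \<equiv> rkhs_inner (space M) K"

text \<open>
  This is the domain of the closure of \<open>T\<close>; no values of the closure occur because they agree with \<open>f\<close>
  almost everywhere.
\<close>

definition closure_dom :: "('a \<Rightarrow> complex) set" where
  "closure_dom = {f \<in> \<H>. f \<in> L2 M \<and>
     (\<forall>e>0. \<exists>d\<in>D. H.nrm (\<lambda>x. d x - f x) < e \<and> L2.nrm (\<lambda>x. d x - f x) < e)}"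

lemma closure_dom_rkhs: "f \<in> closure_dom \<Longrightarrow> f \<in> \<H>"
  and closure_dom_L2: "f \<in> closure_dom \<Longrightarrow> f \<in> L2 M"
  by (simp_all add: closure_dom_def)

lemma D_mem_rkhs: "d \<in> D \<Longrightarrow> d \<in> \<H>"
  and D_mem_L2: "d \<in> D \<Longrightarrow> d \<in> L2 M"
  using D_rkhs D_L2 by auto

lemma D_subset_closure_dom: "D \<subseteq> closure_dom"
proof
  fix d assume d: "d \<in> D"
  have "\<exists>d'\<in>D. H.nrm (\<lambda>x. d' x - d x) < e \<and> L2.nrm (\<lambda>x. d' x - d x) < e" if "0 < e" for e
    using d that H.nrm_zero L2.nrm_zero by (intro bexI[of _ d]) simp_all
  then show "d \<in> closure_dom"
    using D_mem_rkhs[OF d] D_mem_L2[OF d] by (simp add: closure_dom_def)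
qed

lemma closure_dom_sequence:
  assumes "f \<in> closure_dom"
  obtains d where "\<And>n. d n \<in> D"
    "(\<lambda>n. H.nrm (\<lambda>x. d n x - f x)) \<longlonglongrightarrow> 0" "(\<lambda>n. L2.nrm (\<lambda>x. d n x - f x)) \<longlonglongrightarrow> 0"
proof -
  have "\<forall>n. \<exists>d\<in>D. H.nrm (\<lambda>x. d x - f x) < inverse (real (Suc n))
      \<and> L2.nrm (\<lambda>x. d x - f x) < inverse (real (Suc n))"
    using assms unfolding closure_dom_def by simp
  then obtain d where d: "\<And>n. d n \<in> D"
    and H: "\<And>n. H.nrm (\<lambda>x. d n x - f x) < inverse (real (Suc n))"
    and L: "\<And>n. L2.nrm (\<lambda>x. d n x - f x) < inverse (real (Suc n))"
    by metis
  have "(\<lambda>n. H.nrm (\<lambda>x. d n x - f x)) \<longlonglongrightarrow> 0"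
    by (rule Lim_null_comparison[OF always_eventually LIMSEQ_inverse_real_of_nat])
       (use less_imp_le[OF H] H.nrm_nonneg[OF H.diff_mem[OF D_mem_rkhs[OF d] closure_dom_rkhs[OF assms]]]
        in simp)
  moreover have "(\<lambda>n. L2.nrm (\<lambda>x. d n x - f x)) \<longlonglongrightarrow> 0"
    by (rule Lim_null_comparison[OF always_eventually LIMSEQ_inverse_real_of_nat])
       (use less_imp_le[OF L] L2.nrm_nonneg[OF L2.diff_mem[OF D_mem_L2[OF d] closure_dom_L2[OF assms]]]
        in simp)
  ultimately show ?thesis using d that by blast
qed

text \<open>
  Approximants from \<open>closure_dom\<close> itself are admitted, so that the lemma also serves as closedness of the graph.
\<close>

lemma closure_domI_sequence:
  assumes f: "f \<in> \<H>" "f \<in> L2 M" and d: "\<And>n. d n \<in> closure_dom"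
    and H: "(\<lambda>n. H.nrm (\<lambda>x. d n x - f x)) \<longlonglongrightarrow> 0"
    and L: "(\<lambda>n. L2.nrm (\<lambda>x. d n x - f x)) \<longlonglongrightarrow> 0"
  shows "f \<in> closure_dom"
proof -
  have "\<exists>c\<in>D. H.nrm (\<lambda>x. c x - f x) < e \<and> L2.nrm (\<lambda>x. c x - f x) < e" if "0 < e" for e
  proof -
    have e: "0 < e / 2" using that by simp
    obtain N where N: "\<And>n. n \<ge> N \<Longrightarrow> norm (H.nrm (\<lambda>x. d n x - f x) - 0) < e / 2"
      using LIMSEQ_D[OF H e] by blast
    obtain N' where N': "\<And>n. n \<ge> N' \<Longrightarrow> norm (L2.nrm (\<lambda>x. d n x - f x) - 0) < e / 2"
      using LIMSEQ_D[OF L e] by blast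
    define g where "g = d (max N N')"
    have g: "g \<in> closure_dom" unfolding g_def by (rule d)
    have g_f: "H.nrm (\<lambda>x. g x - f x) < e / 2" "L2.nrm (\<lambda>x. g x - f x) < e / 2"
      using N[of "max N N'"] N'[of "max N N'"] by (simp_all add: g_def)
    obtain c where c: "c \<in> D" "H.nrm (\<lambda>x. c x - g x) < e / 2" "L2.nrm (\<lambda>x. c x - g x) < e / 2"
      using g e unfolding closure_dom_def by blast
    show ?thesis
      using c(2,3) g_f H.nrm_diff_triangle[OF D_mem_rkhs[OF c(1)] closure_dom_rkhs[OF g] f(1)]
        L2.nrm_diff_triangle[OF D_mem_L2[OF c(1)] closure_dom_L2[OF g] f(2)]
      by (intro bexI[OF _ c(1)]) simp
  qed
  then show ?thesis using f by (simp add: closure_dom_def)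
qed

lemma fun_subspace_closure_dom: "fun_subspace closure_dom"
  unfolding fun_subspace_def
proof (intro conjI ballI allI)
  have "(\<lambda>_. 0) \<in> D" using D_subspace by (simp add: fun_subspace_def)
  then show "(\<lambda>_. 0) \<in> closure_dom" using D_subset_closure_dom by blast
next
  fix f g assume f: "f \<in> closure_dom" and g: "g \<in> closure_dom"
  obtain c where c: "\<And>n. c n \<in> D" "(\<lambda>n. H.nrm (\<lambda>x. c n x - f x)) \<longlonglongrightarrow> 0"
    "(\<lambda>n. L2.nrm (\<lambda>x. c n x - f x)) \<longlonglongrightarrow> 0" using closure_dom_sequence[OF f] by blast
  obtain d where d: "\<And>n. d n \<in> D" "(\<lambda>n. H.nrm (\<lambda>x. d n x - g x)) \<longlonglongrightarrow> 0"
    "(\<lambda>n. L2.nrm (\<lambda>x. d n x - g x)) \<longlonglongrightarrow> 0" using closure_dom_sequence[OF g] by blast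
  note H_mem = D_mem_rkhs[OF c(1)] D_mem_rkhs[OF d(1)] closure_dom_rkhs[OF f] closure_dom_rkhs[OF g]
  note L_mem = D_mem_L2[OF c(1)] D_mem_L2[OF d(1)] closure_dom_L2[OF f] closure_dom_L2[OF g]
  show "(\<lambda>x. f x + g x) \<in> closure_dom"
  proof (rule closure_domI_sequence)
    show "(\<lambda>x. c n x + d n x) \<in> closure_dom" for n
      using fun_subspace_add[OF D_subspace c(1) d(1)] D_subset_closure_dom by blast
    have "(\<lambda>n. H.nrm (\<lambda>x. c n x - f x) + H.nrm (\<lambda>x. d n x - g x)) \<longlonglongrightarrow> 0"
      using tendsto_add[OF c(2) d(2)] by simp
    then show "(\<lambda>n. H.nrm (\<lambda>x. (c n x + d n x) - (f x + g x))) \<longlonglongrightarrow> 0"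
      by (rule Lim_null_comparison[rotated], intro always_eventually allI)
         (simp only: real_norm_def abs_of_nonneg H.nrm_nonneg H.diff_mem H.add_mem H_mem
           H.nrm_add_diff_le)
    have "(\<lambda>n. L2.nrm (\<lambda>x. c n x - f x) + L2.nrm (\<lambda>x. d n x - g x)) \<longlonglongrightarrow> 0"
      using tendsto_add[OF c(3) d(3)] by simp
    then show "(\<lambda>n. L2.nrm (\<lambda>x. (c n x + d n x) - (f x + g x))) \<longlonglongrightarrow> 0"
      by (rule Lim_null_comparison[rotated], intro always_eventually allI)
         (simp only: real_norm_def abs_of_nonneg L2.nrm_nonneg L2.diff_mem L2.add_mem L_mem
           L2.nrm_add_diff_le)
  qed (intro H.add_mem L2.add_mem H_mem L_mem)+
next
  fix f a assume f: "f \<in> closure_dom"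
  obtain c where c: "\<And>n. c n \<in> D" "(\<lambda>n. H.nrm (\<lambda>x. c n x - f x)) \<longlonglongrightarrow> 0"
    "(\<lambda>n. L2.nrm (\<lambda>x. c n x - f x)) \<longlonglongrightarrow> 0" using closure_dom_sequence[OF f] by blast
  show "(\<lambda>x. a * f x) \<in> closure_dom"
  proof (rule closure_domI_sequence)
    show "(\<lambda>x. a * c n x) \<in> closure_dom" for n
      using fun_subspace_scale[OF D_subspace c(1)] D_subset_closure_dom by blast
    show "(\<lambda>n. H.nrm (\<lambda>x. a * c n x - a * f x)) \<longlonglongrightarrow> 0"
      unfolding H.nrm_scale_diff[OF D_mem_rkhs[OF c(1)] closure_dom_rkhs[OF f]]
      by (rule tendsto_mult_right_zero[OF c(2)])
    show "(\<lambda>n. L2.nrm (\<lambda>x. a * c n x - a * f x)) \<longlonglongrightarrow> 0"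
      unfolding L2.nrm_scale_diff[OF D_mem_L2[OF c(1)] closure_dom_L2[OF f]]
      by (rule tendsto_mult_right_zero[OF c(3)])
  qed (intro H.scale_mem L2.scale_mem closure_dom_rkhs closure_dom_L2 f)+
qed

lemma Domain_T: "Domain T = D"
proof
  show "Domain T \<subseteq> D" by (auto simp: eval_op_def)
  have "(d, d) \<in> T" if "d \<in> D" for d
    using that D_mem_L2[OF that] by (simp add: eval_op_def)
  then show "D \<subseteq> Domain T" by blast
qed

text \<open>
  If \<open>s\<^sub>n \<rightarrow> f\<close> in \<open>H(K)\<close> and the values \<open>T s\<^sub>n\<close> converge to \<open>g\<close> in \<open>L\<^sup>2\<close>, then \<open>s\<^sub>n \<rightarrow> f\<close> pointwise, and a
  sequence that is Cauchy in \<open>L\<^sup>2\<close> and converges pointwise to \<open>f\<close> has no other \<open>L\<^sup>2\<close> limit than \<open>f\<close>.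
\<close>

lemma op_closure_iff:
  "(f, g) \<in> op_closure M K T \<longleftrightarrow> f \<in> closure_dom \<and> g \<in> L2 M \<and> (AE x in M. g x = f x)"
proof
  assume "(f, g) \<in> op_closure M K T"
  then obtain s t where f: "f \<in> \<H>" and g: "g \<in> L2 M" and st: "\<And>n. (s n, t n) \<in> T"
    and s_lim: "(\<lambda>n. H.nrm (\<lambda>x. s n x - f x)) \<longlonglongrightarrow> 0"
    and t_lim: "(\<lambda>n. L2.nrm (\<lambda>x. t n x - g x)) \<longlonglongrightarrow> 0"
    unfolding op_closure_def graph_closure_def rkhs_norm_eq L2_norm_eq by blast
  have s: "s n \<in> D" and t: "t n \<in> L2 M" and ae: "AE x in M. t n x = s n x" for n
    using st[of n] by (simp_all add: eval_op_def)
  note s_L2 = D_mem_L2[OF s] and s_H = D_mem_rkhs[OF s]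
  have same: "L2.nrm (\<lambda>x. s n x - h x) = L2.nrm (\<lambda>x. t n x - h x)" if h: "h \<in> L2 M" for n h
  proof -
    have "AE x in M. s n x - h x = t n x - h x" using ae[of n] by eventually_elim simp
    then show ?thesis
      using L2_norm_cong_AE[OF L2.diff_mem[OF s_L2 h] L2.diff_mem[OF t h]] by (simp only: L2_norm_eq)
  qed
  have s_g: "(\<lambda>n. L2.nrm (\<lambda>x. s n x - g x)) \<longlonglongrightarrow> 0"
    unfolding same[OF g] by (rule t_lim)
  have Cauchy: "form_Cauchy (L2_inner M) s"
    by (rule L2.nrm_diff_LIMSEQ_Cauchy[OF s_L2 g s_g])
  note pointwise = norm_tendsto_imp_pointwise[OF s_H f s_lim]
  have f_L2: "f \<in> L2 M" by (rule L2_Cauchy_pointwise(1)[OF s_L2 Cauchy pointwise])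
  have s_f: "(\<lambda>n. L2.nrm (\<lambda>x. s n x - f x)) \<longlonglongrightarrow> 0"
    using L2_Cauchy_pointwise(2)[OF s_L2 Cauchy pointwise] by (simp only: L2_norm_eq)
  have s_cd: "s n \<in> closure_dom" for n using s D_subset_closure_dom by blast
  have "f \<in> closure_dom" by (rule closure_domI_sequence[OF f f_L2 s_cd s_lim s_f])
  moreover have "L2.nrm (\<lambda>x. g x - f x) = 0"
    by (rule L2.nrm_limit_unique[OF s_L2 g f_L2 s_g s_f])
  then have "AE x in M. g x - f x = 0"
    using L2_norm_eq_0_imp_AE[OF L2.diff_mem[OF g f_L2]] by (simp only: L2_norm_eq)
  then have "AE x in M. g x = f x" by simp
  ultimately show "f \<in> closure_dom \<and> g \<in> L2 M \<and> (AE x in M. g x = f x)" using g by blast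
next
  assume *: "f \<in> closure_dom \<and> g \<in> L2 M \<and> (AE x in M. g x = f x)"
  then have f: "f \<in> closure_dom" and g: "g \<in> L2 M" and ae: "AE x in M. g x = f x" by auto
  obtain d where d: "\<And>n. d n \<in> D" "(\<lambda>n. H.nrm (\<lambda>x. d n x - f x)) \<longlonglongrightarrow> 0"
    "(\<lambda>n. L2.nrm (\<lambda>x. d n x - f x)) \<longlonglongrightarrow> 0" using closure_dom_sequence[OF f] by blast
  have "L2.nrm (\<lambda>x. d n x - g x) = L2.nrm (\<lambda>x. d n x - f x)" for n
  proof -
    have "AE x in M. d n x - g x = d n x - f x" using ae by eventually_elim simp
    then show ?thesis
      using L2_norm_cong_AE[OF L2.diff_mem[OF D_mem_L2[OF d(1)] g]
          L2.diff_mem[OF D_mem_L2[OF d(1)] closure_dom_L2[OF f]]] by (simp only: L2_norm_eq)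
  qed
  then have d_g: "(\<lambda>n. L2.nrm (\<lambda>x. d n x - g x)) \<longlonglongrightarrow> 0" using d(3) by simp
  have "(d n, d n) \<in> T" for n using d(1) D_mem_L2[OF d(1)] by (simp add: eval_op_def)
  then show "(f, g) \<in> op_closure M K T"
    unfolding op_closure_def graph_closure_def rkhs_norm_eq L2_norm_eq
    using closure_dom_rkhs[OF f] g d(2) d_g by blast
qed

text \<open>
  Both sides of the adjoint identity are continuous for the graph norm, so testing on \<open>D\<close> is the same as
  testing on the domain of the closure: \<open>T\<close> and its closure have the same adjoint.
\<close>

lemma adjoint_op_iff:
  "(\<psi>, h) \<in> adjoint_op M K T \<longleftrightarrow>
     \<psi> \<in> L2 M \<and> h \<in> \<H> \<and> (\<forall>u\<in>closure_dom. inner_H u h = L2_inner M u \<psi>)"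
proof
  assume "(\<psi>, h) \<in> adjoint_op M K T"
  then have \<psi>: "\<psi> \<in> L2 M" and h: "h \<in> \<H>"
    and eq: "\<And>f g. (f, g) \<in> T \<Longrightarrow> inner_H f h = L2_inner M g \<psi>"
    unfolding adjoint_op_def by auto
  have "inner_H u h = L2_inner M u \<psi>" if u: "u \<in> closure_dom" for u
  proof -
    obtain d where d: "\<And>n. d n \<in> D" "(\<lambda>n. H.nrm (\<lambda>x. d n x - u x)) \<longlonglongrightarrow> 0"
      "(\<lambda>n. L2.nrm (\<lambda>x. d n x - u x)) \<longlonglongrightarrow> 0" using closure_dom_sequence[OF u] by blast
    have "(d n, d n) \<in> T" for n using d(1) D_mem_L2[OF d(1)] by (simp add: eval_op_def)
    then have "inner_H (d n) h = L2_inner M (d n) \<psi>" for n by (rule eq)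
    then have "(\<lambda>n. inner_H (d n) h) = (\<lambda>n. L2_inner M (d n) \<psi>)" by simp
    moreover have "(\<lambda>n. inner_H (d n) h) \<longlonglongrightarrow> inner_H u h"
      by (rule H.form_tendsto_left[OF D_mem_rkhs[OF d(1)] closure_dom_rkhs[OF u] h d(2)])
    moreover have "(\<lambda>n. L2_inner M (d n) \<psi>) \<longlonglongrightarrow> L2_inner M u \<psi>"
      by (rule L2.form_tendsto_left[OF D_mem_L2[OF d(1)] closure_dom_L2[OF u] \<psi> d(3)])
    ultimately show ?thesis using LIMSEQ_unique by metis
  qed
  then show "\<psi> \<in> L2 M \<and> h \<in> \<H> \<and> (\<forall>u\<in>closure_dom. inner_H u h = L2_inner M u \<psi>)"
    using \<psi> h by blast
next
  assume *: "\<psi> \<in> L2 M \<and> h \<in> \<H> \<and> (\<forall>u\<in>closure_dom. inner_H u h = L2_inner M u \<psi>)"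
  have "inner_H f h = L2_inner M g \<psi>" if "(f, g) \<in> T" for f g
  proof -
    have f: "f \<in> D" and g: "g \<in> L2 M" "AE x in M. g x = f x" using that by (auto simp: eval_op_def)
    have "inner_H f h = L2_inner M f \<psi>" using f * D_subset_closure_dom by blast
    also have "\<dots> = L2_inner M g \<psi>"
      using L2_inner_cong_AE[OF g(1) D_mem_L2[OF f] _ g(2)] * by simp
    finally show ?thesis .
  qed
  then show "(\<psi>, h) \<in> adjoint_op M K T" using * unfolding adjoint_op_def by auto
qed

lemma normal_op_iff:
  "(f, k) \<in> normal_op M K T \<longleftrightarrow>
     f \<in> closure_dom \<and> k \<in> \<H> \<and> (\<forall>u\<in>closure_dom. inner_H u k = L2_inner M u f)"
proof
  assume "(f, k) \<in> normal_op M K T"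
  then obtain g where fg: "(f, g) \<in> op_closure M K T" and gk: "(g, k) \<in> adjoint_op M K T"
    by (auto simp: normal_op_def)
  have f: "f \<in> closure_dom" and g: "g \<in> L2 M" and ae: "AE x in M. g x = f x"
    using fg unfolding op_closure_iff by auto
  have "L2_inner M u g = L2_inner M u f" if "u \<in> closure_dom" for u
    using L2_inner_cong_AE[OF g closure_dom_L2[OF f] closure_dom_L2[OF that] ae]
      L2.herm[OF g closure_dom_L2[OF that]] L2.herm[OF closure_dom_L2[OF f] closure_dom_L2[OF that]]
    by simp
  then show "f \<in> closure_dom \<and> k \<in> \<H> \<and> (\<forall>u\<in>closure_dom. inner_H u k = L2_inner M u f)"
    using f gk unfolding adjoint_op_iff by auto
next
  assume *: "f \<in> closure_dom \<and> k \<in> \<H> \<and> (\<forall>u\<in>closure_dom. inner_H u k = L2_inner M u f)"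
  then have "(f, f) \<in> op_closure M K T" "(f, k) \<in> adjoint_op M K T"
    unfolding op_closure_iff adjoint_op_iff using closure_dom_L2 by auto
  then show "(f, k) \<in> normal_op M K T" unfolding normal_op_def by blast
qed

definition graph_inner :: "real \<Rightarrow> ('a \<Rightarrow> complex) \<Rightarrow> ('a \<Rightarrow> complex) \<Rightarrow> complex" where
  "graph_inner \<beta> u v = L2_inner M u v + of_real \<beta> * inner_H u v"

lemma shift_op_iff:
  "(f, h) \<in> shift_op \<beta> (normal_op M K T) \<longleftrightarrow>
     f \<in> closure_dom \<and> h \<in> \<H> \<and> (\<forall>u\<in>closure_dom. graph_inner \<beta> u f = inner_H u h)"
proof
  assume "(f, h) \<in> shift_op \<beta> (normal_op M K T)"
  then obtain k where fk: "(f, k) \<in> normal_op M K T" and h: "h = (\<lambda>x. of_real \<beta> * f x + k x)"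
    unfolding shift_op_def by blast
  have f: "f \<in> closure_dom" and k: "k \<in> \<H>"
    and eq: "\<And>u. u \<in> closure_dom \<Longrightarrow> inner_H u k = L2_inner M u f"
    using fk unfolding normal_op_iff by auto
  have sf: "(\<lambda>x. of_real \<beta> * f x) \<in> \<H>" by (rule H.scale_mem[OF closure_dom_rkhs[OF f]])
  have "graph_inner \<beta> u f = inner_H u h" if u: "u \<in> closure_dom" for u
    unfolding h graph_inner_def
    by (simp add: H.add_right[OF closure_dom_rkhs[OF u] sf k] eq[OF u]
        H.scale_right[OF closure_dom_rkhs[OF u] closure_dom_rkhs[OF f]])
  then show "f \<in> closure_dom \<and> h \<in> \<H> \<and> (\<forall>u\<in>closure_dom. graph_inner \<beta> u f = inner_H u h)"
    using f H.add_mem[OF sf k] h by simp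
next
  assume *: "f \<in> closure_dom \<and> h \<in> \<H> \<and> (\<forall>u\<in>closure_dom. graph_inner \<beta> u f = inner_H u h)"
  then have f: "f \<in> closure_dom" and h: "h \<in> \<H>" by auto
  have sf: "(\<lambda>x. of_real \<beta> * f x) \<in> \<H>" by (rule H.scale_mem[OF closure_dom_rkhs[OF f]])
  define k where "k = (\<lambda>x. h x - of_real \<beta> * f x)"
  have "inner_H u k = L2_inner M u f" if u: "u \<in> closure_dom" for u
  proof -
    have "graph_inner \<beta> u f = inner_H u h" using * u by blast
    then show ?thesis
      unfolding k_def graph_inner_def
      by (simp add: H.diff_right[OF closure_dom_rkhs[OF u] h sf]
          H.scale_right[OF closure_dom_rkhs[OF u] closure_dom_rkhs[OF f]])
         (metis add_diff_cancel_right')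
  qed
  then have "(f, k) \<in> normal_op M K T"
    using f H.diff_mem[OF h sf] unfolding normal_op_iff k_def by blast
  moreover have "h = (\<lambda>x. of_real \<beta> * f x + k x)" by (simp add: k_def)
  ultimately show "(f, h) \<in> shift_op \<beta> (normal_op M K T)" unfolding shift_op_def by blast
qed

text \<open>
  The equation \<open>(\<beta> I + T\<^sup>* T) F = T\<^sup>* \<psi>\<close> in weak form, which makes sense even if \<open>\<psi>\<close> is not in the domain
  of \<open>T\<^sup>*\<close>; it is also the Euler equation of the Tikhonov functional.
\<close>

definition weak_solution :: "real \<Rightarrow> ('a \<Rightarrow> complex) \<Rightarrow> ('a \<Rightarrow> complex) \<Rightarrow> bool" where
  "weak_solution \<beta> \<psi> F \<longleftrightarrow>
     F \<in> closure_dom \<and> (\<forall>u\<in>closure_dom. graph_inner \<beta> u F = L2_inner M u \<psi>)"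

lemma regularized_inverse_iff:
  "(\<psi>, f) \<in> regularized_inverse M K T \<beta> \<longleftrightarrow>
     \<psi> \<in> Domain (adjoint_op M K T) \<and> weak_solution \<beta> \<psi> f"
proof
  assume "(\<psi>, f) \<in> regularized_inverse M K T \<beta>"
  then obtain h where "(\<psi>, h) \<in> adjoint_op M K T" "(f, h) \<in> shift_op \<beta> (normal_op M K T)"
    unfolding regularized_inverse_def by blast
  then show "\<psi> \<in> Domain (adjoint_op M K T) \<and> weak_solution \<beta> \<psi> f"
    unfolding shift_op_iff weak_solution_def by (auto simp: adjoint_op_iff)
next
  assume *: "\<psi> \<in> Domain (adjoint_op M K T) \<and> weak_solution \<beta> \<psi> f"
  then obtain h where h: "(\<psi>, h) \<in> adjoint_op M K T" by blast
  then have "(f, h) \<in> shift_op \<beta> (normal_op M K T)"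
    using * unfolding adjoint_op_iff shift_op_iff weak_solution_def by auto
  then show "(\<psi>, f) \<in> regularized_inverse M K T \<beta>"
    using h unfolding regularized_inverse_def by blast
qed

section \<open>The regularized normal equation\<close>

lemma psd_form_graph_inner:
  assumes "0 \<le> \<beta>"
  shows "psd_form closure_dom (graph_inner \<beta>)"
proof
  show "fun_subspace closure_dom" by (rule fun_subspace_closure_dom)
next
  fix u v w assume "u \<in> closure_dom" "v \<in> closure_dom" "w \<in> closure_dom"
  then show "graph_inner \<beta> u (\<lambda>x. v x + w x) = graph_inner \<beta> u v + graph_inner \<beta> u w"
    by (simp add: graph_inner_def H.add_right L2.add_right closure_dom_rkhs closure_dom_L2
        algebra_simps)
next
  fix u v c assume u: "u \<in> closure_dom" and v: "v \<in> closure_dom"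
  show "graph_inner \<beta> u (\<lambda>x. c * v x) = c * graph_inner \<beta> u v"
    using u v by (simp add: graph_inner_def H.scale_right L2.scale_right closure_dom_rkhs
        closure_dom_L2 algebra_simps)
  show "graph_inner \<beta> v u = cnj (graph_inner \<beta> u v)"
    using H.herm[OF closure_dom_rkhs[OF u] closure_dom_rkhs[OF v]]
      L2.herm[OF closure_dom_L2[OF u] closure_dom_L2[OF v]] by (simp add: graph_inner_def)
  show "0 \<le> Re (graph_inner \<beta> u u)"
    using assms H.Re_nonneg[OF closure_dom_rkhs[OF u]] L2.Re_nonneg[OF closure_dom_L2[OF u]]
    by (simp add: graph_inner_def)
qed

lemma graph_norm_power2:
  assumes "0 \<le> \<beta>" and u: "u \<in> closure_dom"
  shows "(form_norm (graph_inner \<beta>) u)\<^sup>2 = (L2.nrm u)\<^sup>2 + \<beta> * (H.nrm u)\<^sup>2"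
  by (simp add: psd_form.nrm_power2[OF psd_form_graph_inner[OF assms(1)] u]
      L2.nrm_power2[OF closure_dom_L2[OF u]] H.nrm_power2[OF closure_dom_rkhs[OF u]]
      graph_inner_def)

lemma L2_norm_le_graph_norm:
  assumes "0 \<le> \<beta>" and u: "u \<in> closure_dom"
  shows "L2.nrm u \<le> form_norm (graph_inner \<beta>) u"
proof (rule power2_le_imp_le)
  show "(L2.nrm u)\<^sup>2 \<le> (form_norm (graph_inner \<beta>) u)\<^sup>2"
    using assms by (simp add: graph_norm_power2)
  show "0 \<le> form_norm (graph_inner \<beta>) u"
    by (rule psd_form.nrm_nonneg[OF psd_form_graph_inner[OF assms(1)] u])
qed

lemma rkhs_norm_le_graph_norm:
  assumes "0 < \<beta>" and u: "u \<in> closure_dom"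
  shows "H.nrm u \<le> form_norm (graph_inner \<beta>) u / sqrt \<beta>"
proof -
  have "sqrt \<beta> * H.nrm u \<le> form_norm (graph_inner \<beta>) u"
  proof (rule power2_le_imp_le)
    show "(sqrt \<beta> * H.nrm u)\<^sup>2 \<le> (form_norm (graph_inner \<beta>) u)\<^sup>2"
      using assms by (simp add: graph_norm_power2 power_mult_distrib)
    show "0 \<le> form_norm (graph_inner \<beta>) u"
      by (rule psd_form.nrm_nonneg[OF psd_form_graph_inner u]) (use assms in simp)
  qed
  then show ?thesis using assms(1) by (simp add: pos_le_divide_eq mult.commute)
qed

lemma graph_norm_tendsto_zero:
  assumes "0 \<le> \<beta>" "\<And>n. u n \<in> closure_dom"
    and "(\<lambda>n. H.nrm (u n)) \<longlonglongrightarrow> 0" "(\<lambda>n. L2.nrm (u n)) \<longlonglongrightarrow> 0"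
  shows "(\<lambda>n. form_norm (graph_inner \<beta>) (u n)) \<longlonglongrightarrow> 0"
proof -
  have eq: "form_norm (graph_inner \<beta>) (u n) = sqrt ((L2.nrm (u n))\<^sup>2 + \<beta> * (H.nrm (u n))\<^sup>2)" for n
    using graph_norm_power2[OF assms(1,2), of n]
      psd_form.nrm_nonneg[OF psd_form_graph_inner[OF assms(1)] assms(2), of n]
    by (metis real_sqrt_unique)
  have "(\<lambda>n. sqrt ((L2.nrm (u n))\<^sup>2 + \<beta> * (H.nrm (u n))\<^sup>2)) \<longlonglongrightarrow> sqrt (0\<^sup>2 + \<beta> * 0\<^sup>2)"
    using assms(3,4) by (intro tendsto_intros)
  then show ?thesis by (simp add: eq)
qed

text \<open>
  A Cauchy sequence for the graph norm is Cauchy in both spaces; the limit in \<open>H(K)\<close> is a pointwise limit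
  and therefore the limit in \<open>L\<^sup>2\<close> as well.
\<close>

theorem closure_dom_complete:
  assumes \<beta>: "0 < \<beta>" and s: "\<And>n. s n \<in> closure_dom" and Cauchy: "form_Cauchy (graph_inner \<beta>) s"
  shows "\<exists>f\<in>closure_dom. (\<lambda>n. form_norm (graph_inner \<beta>) (\<lambda>x. s n x - f x)) \<longlonglongrightarrow> 0"
proof -
  interpret G: psd_form closure_dom "graph_inner \<beta>"
    using psd_form_graph_inner[OF less_imp_le[OF \<beta>]] .
  note s_H = closure_dom_rkhs[OF s] and s_L2 = closure_dom_L2[OF s]
  have "form_Cauchy inner_H s"
    unfolding form_Cauchy_def
  proof (intro allI impI)
    fix e :: real assume "0 < e"
    then have "0 < sqrt \<beta> * e" using \<beta> by simp
    then obtain N where N: "\<And>m n. m \<ge> N \<Longrightarrow> n \<ge> N \<Longrightarrow> G.nrm (\<lambda>x. s m x - s n x) < sqrt \<beta> * e"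
      using Cauchy unfolding form_Cauchy_def by blast
    have "H.nrm (\<lambda>x. s m x - s n x) < e" if "m \<ge> N" "n \<ge> N" for m n
    proof -
      have "G.nrm (\<lambda>x. s m x - s n x) / sqrt \<beta> < e"
        using N[OF that] \<beta> by (simp add: pos_divide_less_eq mult.commute)
      then show ?thesis
        using rkhs_norm_le_graph_norm[OF \<beta> G.diff_mem[OF s s], of m n] by linarith
    qed
    then show "\<exists>N. \<forall>m\<ge>N. \<forall>n\<ge>N. H.nrm (\<lambda>x. s m x - s n x) < e" by blast
  qed
  then obtain f where f: "f \<in> \<H>" and f_lim: "(\<lambda>n. H.nrm (\<lambda>x. s n x - f x)) \<longlonglongrightarrow> 0"
    using rkhs_complete s_H by blast
  have "form_Cauchy (L2_inner M) s"
    unfolding form_Cauchy_def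
  proof (intro allI impI)
    fix e :: real assume "0 < e"
    then obtain N where N: "\<And>m n. m \<ge> N \<Longrightarrow> n \<ge> N \<Longrightarrow> G.nrm (\<lambda>x. s m x - s n x) < e"
      using Cauchy unfolding form_Cauchy_def by blast
    have "L2.nrm (\<lambda>x. s m x - s n x) < e" if "m \<ge> N" "n \<ge> N" for m n
      using L2_norm_le_graph_norm[OF less_imp_le[OF \<beta>] G.diff_mem[OF s s], of m n] N[OF that]
      by linarith
    then show "\<exists>N. \<forall>m\<ge>N. \<forall>n\<ge>N. L2.nrm (\<lambda>x. s m x - s n x) < e" by blast
  qed
  note limits = L2_Cauchy_pointwise[OF s_L2 this norm_tendsto_imp_pointwise[OF s_H f f_lim],
      unfolded L2_norm_eq]
  have f_cd: "f \<in> closure_dom"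
    by (rule closure_domI_sequence[OF f limits(1) s f_lim limits(2)])
  have "(\<lambda>n. G.nrm (\<lambda>x. s n x - f x)) \<longlonglongrightarrow> 0"
    by (rule graph_norm_tendsto_zero[OF less_imp_le[OF \<beta>] G.diff_mem[OF s f_cd] f_lim limits(2)])
  then show ?thesis using f_cd by blast
qed

lemma graph_solution_unique:
  assumes \<beta>: "0 < \<beta>" and f: "f \<in> closure_dom" and g: "g \<in> closure_dom"
    and eq: "\<And>u. u \<in> closure_dom \<Longrightarrow> graph_inner \<beta> u f = graph_inner \<beta> u g"
  shows "f = g"
proof -
  interpret G: psd_form closure_dom "graph_inner \<beta>"
    using psd_form_graph_inner[OF less_imp_le[OF \<beta>]] .
  note d = G.diff_mem[OF f g]
  have "(G.nrm (\<lambda>x. f x - g x))\<^sup>2 = 0"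
    using eq[OF d] by (simp add: G.nrm_power2[OF d] G.diff_right[OF d f g])
  then have "H.nrm (\<lambda>x. f x - g x) \<le> 0"
    using rkhs_norm_le_graph_norm[OF \<beta> d] by simp
  then have "H.nrm (\<lambda>x. f x - g x) = 0"
    using H.nrm_nonneg[OF closure_dom_rkhs[OF d]] by simp
  then show ?thesis by (rule eq_if_dist_zero[OF closure_dom_rkhs[OF f] closure_dom_rkhs[OF g]])
qed

theorem shift_normal_op_bijective:
  assumes \<beta>: "0 < \<beta>" and h: "h \<in> \<H>"
  shows "\<exists>!f. (f, h) \<in> shift_op \<beta> (normal_op M K T)"
proof -
  interpret G: psd_form closure_dom "graph_inner \<beta>"
    using psd_form_graph_inner[OF less_imp_le[OF \<beta>]] .
  have "\<exists>f\<in>closure_dom. \<forall>u\<in>closure_dom. graph_inner \<beta> u f = inner_H u h"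
  proof (rule G.Riesz_representation)
    show "\<exists>f\<in>closure_dom. (\<lambda>n. G.nrm (\<lambda>x. u n x - f x)) \<longlonglongrightarrow> 0"
      if "\<And>n. u n \<in> closure_dom" "form_Cauchy (graph_inner \<beta>) u" for u
      by (rule closure_dom_complete[OF \<beta> that])
    fix u assume u: "u \<in> closure_dom"
    show "inner_H (\<lambda>x. u x + v x) h = inner_H u h + inner_H v h" if "v \<in> closure_dom" for v
      by (rule H.add_left[OF h closure_dom_rkhs[OF u] closure_dom_rkhs[OF that]])
    show "inner_H (\<lambda>x. c * u x) h = cnj c * inner_H u h" for c
      by (rule H.scale_left[OF h closure_dom_rkhs[OF u]])
    have "cmod (inner_H u h) \<le> H.nrm u * H.nrm h"
      by (rule H.Cauchy_Schwarz[OF closure_dom_rkhs[OF u] h])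
    also have "\<dots> \<le> G.nrm u / sqrt \<beta> * H.nrm h"
      by (intro mult_right_mono rkhs_norm_le_graph_norm \<beta> u H.nrm_nonneg h)
    finally show "cmod (inner_H u h) \<le> (H.nrm h / sqrt \<beta>) * G.nrm u"
      by (simp add: mult.commute)
  qed
  then obtain f where f: "f \<in> closure_dom" "\<forall>u\<in>closure_dom. graph_inner \<beta> u f = inner_H u h"
    by blast
  show ?thesis
  proof (rule ex1I)
    show "(f, h) \<in> shift_op \<beta> (normal_op M K T)" unfolding shift_op_iff using f h by blast
    fix g assume "(g, h) \<in> shift_op \<beta> (normal_op M K T)"
    then show "g = f" unfolding shift_op_iff using f graph_solution_unique[OF \<beta>, of g f] by simp
  qed
qed

theorem weak_solution_exists:
  assumes \<beta>: "0 < \<beta>" and \<psi>: "\<psi> \<in> L2 M"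
  shows "\<exists>F. weak_solution \<beta> \<psi> F"
proof -
  interpret G: psd_form closure_dom "graph_inner \<beta>"
    using psd_form_graph_inner[OF less_imp_le[OF \<beta>]] .
  have "\<exists>f\<in>closure_dom. \<forall>u\<in>closure_dom. graph_inner \<beta> u f = L2_inner M u \<psi>"
  proof (rule G.Riesz_representation)
    show "\<exists>f\<in>closure_dom. (\<lambda>n. G.nrm (\<lambda>x. u n x - f x)) \<longlonglongrightarrow> 0"
      if "\<And>n. u n \<in> closure_dom" "form_Cauchy (graph_inner \<beta>) u" for u
      by (rule closure_dom_complete[OF \<beta> that])
    fix u assume u: "u \<in> closure_dom"
    show "L2_inner M (\<lambda>x. u x + v x) \<psi> = L2_inner M u \<psi> + L2_inner M v \<psi>"
      if "v \<in> closure_dom" for v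
      by (rule L2.add_left[OF \<psi> closure_dom_L2[OF u] closure_dom_L2[OF that]])
    show "L2_inner M (\<lambda>x. c * u x) \<psi> = cnj c * L2_inner M u \<psi>" for c
      by (rule L2.scale_left[OF \<psi> closure_dom_L2[OF u]])
    have "cmod (L2_inner M u \<psi>) \<le> L2.nrm u * L2.nrm \<psi>"
      by (rule L2.Cauchy_Schwarz[OF closure_dom_L2[OF u] \<psi>])
    also have "\<dots> \<le> G.nrm u * L2.nrm \<psi>"
      by (intro mult_right_mono L2_norm_le_graph_norm less_imp_le[OF \<beta>] u L2.nrm_nonneg \<psi>)
    finally show "cmod (L2_inner M u \<psi>) \<le> L2.nrm \<psi> * G.nrm u" by (simp add: mult.commute)
  qed
  then show ?thesis unfolding weak_solution_def by blast
qed

lemma weak_solution_unique: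
  assumes "0 < \<beta>" "weak_solution \<beta> \<psi> F" "weak_solution \<beta> \<psi> F'"
  shows "F = F'"
  using assms(2,3) by (intro graph_solution_unique[OF assms(1)]) (simp_all add: weak_solution_def)

lemma weak_solution_diff:
  assumes \<beta>: "0 < \<beta>" and \<psi>: "\<psi> \<in> L2 M" "\<psi>' \<in> L2 M"
    and F: "weak_solution \<beta> \<psi> F" "weak_solution \<beta> \<psi>' F'"
  shows "weak_solution \<beta> (\<lambda>x. \<psi> x - \<psi>' x) (\<lambda>x. F x - F' x)"
proof -
  interpret G: psd_form closure_dom "graph_inner \<beta>"
    using psd_form_graph_inner[OF less_imp_le[OF \<beta>]] .
  show ?thesis
    using F unfolding weak_solution_def
    by (simp add: G.diff_mem G.diff_right L2.diff_right[OF closure_dom_L2 \<psi>])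
qed

lemma weak_solution_energy:
  assumes \<beta>: "0 < \<beta>" and F: "weak_solution \<beta> \<psi> F"
  shows "(L2.nrm F)\<^sup>2 + \<beta> * (H.nrm F)\<^sup>2 = Re (L2_inner M F \<psi>)"
proof -
  interpret G: psd_form closure_dom "graph_inner \<beta>"
    using psd_form_graph_inner[OF less_imp_le[OF \<beta>]] .
  have cd: "F \<in> closure_dom" using F by (simp add: weak_solution_def)
  have "(G.nrm F)\<^sup>2 = Re (L2_inner M F \<psi>)"
    using F cd by (simp add: G.nrm_power2 weak_solution_def)
  then show ?thesis using graph_norm_power2[OF less_imp_le[OF \<beta>] cd] by simp
qed

text \<open>
  Testing the equation with \<open>F\<close> gives \<open>\<parallel>F\<parallel>\<^sup>2 + \<beta> \<parallel>F\<parallel>\<^bsub>H(K)\<^esub>\<^sup>2 \<le> \<parallel>F\<parallel> \<parallel>\<psi>\<parallel>\<close>, and the product on the right is at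
  most \<open>(\<parallel>F\<parallel>\<^sup>2 + \<parallel>\<psi>\<parallel>\<^sup>2) / 2\<close>.
\<close>

lemma weak_solution_bound:
  assumes \<beta>: "0 < \<beta>" and \<psi>: "\<psi> \<in> L2 M" and F: "weak_solution \<beta> \<psi> F"
  shows "H.nrm F \<le> L2.nrm \<psi> / sqrt \<beta>"
proof -
  have cd: "F \<in> closure_dom" using F by (simp add: weak_solution_def)
  note F_L2 = closure_dom_L2[OF cd]
  have energy: "(L2.nrm F)\<^sup>2 + \<beta> * (H.nrm F)\<^sup>2 \<le> L2.nrm F * L2.nrm \<psi>"
    using weak_solution_energy[OF \<beta> F] L2.Re_Cauchy_Schwarz[OF F_L2 \<psi>] by simp
  have "2 * (L2.nrm F * L2.nrm \<psi>) \<le> (L2.nrm F)\<^sup>2 + (L2.nrm \<psi>)\<^sup>2"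
    using sum_squares_bound[of "L2.nrm F" "L2.nrm \<psi>"] by simp
  moreover have "0 \<le> (L2.nrm F)\<^sup>2" "0 \<le> \<beta> * (H.nrm F)\<^sup>2" using \<beta> by simp_all
  ultimately have "\<beta> * (H.nrm F)\<^sup>2 \<le> (L2.nrm \<psi>)\<^sup>2" using energy by linarith
  then have "(sqrt \<beta> * H.nrm F)\<^sup>2 \<le> (L2.nrm \<psi>)\<^sup>2" using \<beta> by (simp add: power_mult_distrib)
  then have "sqrt \<beta> * H.nrm F \<le> L2.nrm \<psi>" by (rule power2_le_imp_le) (rule L2.nrm_nonneg[OF \<psi>])
  then show ?thesis using \<beta> by (simp add: pos_le_divide_eq mult.commute)
qed

section \<open>Density of the domain of the adjoint and extension by continuity\<close>

text \<open>
  The minimal value of the functional is \<open>\<parallel>\<psi>\<parallel>\<^sup>2 - Re \<langle>F, \<psi>\<rangle>\<close>, which grows with the parameter. Evaluating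
  the \<open>\<beta>\<close>-functional at the \<open>\<gamma>\<close>-minimizer shows that the growth dominates the squared distance of the
  minimizers, in the \<open>\<beta>\<close>-graph norm and a fortiori in \<open>L\<^sup>2\<close>.
\<close>

lemma weak_solution_monotone:
  assumes \<beta>: "0 < \<beta>" "\<beta> \<le> \<gamma>" and F: "weak_solution \<beta> \<psi> F" and F': "weak_solution \<gamma> \<psi> F'"
  shows "(L2.nrm (\<lambda>x. F' x - F x))\<^sup>2 \<le> Re (L2_inner M F \<psi>) - Re (L2_inner M F' \<psi>)"
proof -
  interpret G: psd_form closure_dom "graph_inner \<beta>"
    using psd_form_graph_inner[OF less_imp_le[OF \<beta>(1)]] .
  have cd: "F \<in> closure_dom" "F' \<in> closure_dom" using F F' by (simp_all add: weak_solution_def)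
  have "(L2.nrm (\<lambda>x. F' x - F x))\<^sup>2 \<le> (G.nrm (\<lambda>x. F' x - F x))\<^sup>2"
    using \<beta>(1) by (simp add: graph_norm_power2 G.diff_mem cd)
  also have "\<dots> = (G.nrm F')\<^sup>2 - 2 * Re (graph_inner \<beta> F' F) + (G.nrm F)\<^sup>2"
    by (rule G.nrm_diff_power2[OF cd(2,1)])
  also have "graph_inner \<beta> F' F = L2_inner M F' \<psi>" using F cd by (simp add: weak_solution_def)
  also have "(G.nrm F)\<^sup>2 = Re (L2_inner M F \<psi>)"
    using F cd by (simp add: G.nrm_power2 weak_solution_def)
  also have "(G.nrm F')\<^sup>2 \<le> (L2.nrm F')\<^sup>2 + \<gamma> * (H.nrm F')\<^sup>2"
    using \<beta> by (simp add: graph_norm_power2 cd mult_right_mono)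
  also have "\<dots> = Re (L2_inner M F' \<psi>)"
    using \<beta> by (intro weak_solution_energy F') simp
  finally show ?thesis by simp
qed

text \<open>
  Rearranged, the weak equation reads \<open>\<langle>u, \<psi> - F\<rangle> = \<langle>u, \<beta> F\<rangle>\<^bsub>H(K)\<^esub>\<close>, that is \<open>T\<^sup>* (\<psi> - F) = \<beta> F\<close>.
\<close>

lemma residual_mem_Domain_adjoint:
  assumes \<beta>: "0 < \<beta>" and \<psi>: "\<psi> \<in> L2 M" and F: "weak_solution \<beta> \<psi> F"
  shows "(\<lambda>x. \<psi> x - F x) \<in> Domain (adjoint_op M K T)"
proof -
  have cd: "F \<in> closure_dom" using F by (simp add: weak_solution_def)
  have "inner_H u (\<lambda>x. of_real \<beta> * F x) = L2_inner M u (\<lambda>x. \<psi> x - F x)"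
    if u: "u \<in> closure_dom" for u
  proof -
    have "L2_inner M u F + of_real \<beta> * inner_H u F = L2_inner M u \<psi>"
      using F u by (simp add: weak_solution_def graph_inner_def)
    then show ?thesis
      by (simp add: H.scale_right[OF closure_dom_rkhs[OF u] closure_dom_rkhs[OF cd]]
          L2.diff_right[OF closure_dom_L2[OF u] \<psi> closure_dom_L2[OF cd]] eq_diff_eq add.commute)
  qed
  then have "(\<lambda>x. \<psi> x - F x, \<lambda>x. of_real \<beta> * F x) \<in> adjoint_op M K T"
    unfolding adjoint_op_iff
    using L2.diff_mem[OF \<psi> closure_dom_L2[OF cd]] H.scale_mem[OF closure_dom_rkhs[OF cd]] by simp
  then show ?thesis by blast
qed

text \<open>
  The residuals for a parameter growing to infinity approximate \<open>\<psi>\<close>. The bound on the weak solutions only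
  makes them small in \<open>H(K)\<close>; that they are small in \<open>L\<^sup>2\<close> needs the Cauchy property supplied by monotonicity.
\<close>

theorem Domain_adjoint_dense:
  assumes \<psi>: "\<psi> \<in> L2 M"
  obtains s where "\<And>n. s n \<in> Domain (adjoint_op M K T)"
    "(\<lambda>n. L2.nrm (\<lambda>x. s n x - \<psi> x)) \<longlonglongrightarrow> 0"
proof -
  define b :: "nat \<Rightarrow> real" where "b n = real (Suc n)" for n
  have b: "0 < b n" for n by (simp add: b_def)
  have "\<forall>n. \<exists>F. weak_solution (b n) \<psi> F" using weak_solution_exists[OF b \<psi>] by blast
  then obtain F where F: "\<And>n. weak_solution (b n) \<psi> (F n)" by metis
  have cd: "F n \<in> closure_dom" for n using F by (simp add: weak_solution_def)
  note F_H = closure_dom_rkhs[OF cd] and F_L2 = closure_dom_L2[OF cd]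
  define a where "a n = Re (L2_inner M (F n) \<psi>)" for n
  have step: "(L2.nrm (\<lambda>x. F n x - F m x))\<^sup>2 \<le> a m - a n" if "m \<le> n" for m n
    unfolding a_def using that by (intro weak_solution_monotone[OF b _ F F]) (simp add: b_def)
  have "decseq a"
    unfolding decseq_def
  proof (intro allI impI)
    fix m n :: nat assume "m \<le> n"
    from step[OF this] show "a n \<le> a m"
      using zero_le_power2[of "L2.nrm (\<lambda>x. F n x - F m x)"] by linarith
  qed
  moreover have "0 \<le> a n" for n
    using weak_solution_energy[OF b F, of n] less_imp_le[OF b, of n] unfolding a_def
    by (metis add_nonneg_nonneg mult_nonneg_nonneg zero_le_power2)
  ultimately have "Cauchy a"
    using decseq_convergent[of a 0] by (metis LIMSEQ_imp_Cauchy)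
  have "form_Cauchy (L2_inner M) F"
    unfolding form_Cauchy_def
  proof (intro allI impI)
    fix e :: real assume e: "0 < e"
    then obtain N where N: "\<And>m n. m \<ge> N \<Longrightarrow> n \<ge> N \<Longrightarrow> norm (a m - a n) < e\<^sup>2"
      using CauchyD[OF \<open>Cauchy a\<close>, of "e\<^sup>2"] by auto
    have ordered: "L2.nrm (\<lambda>x. F n x - F m x) < e" if "m \<ge> N" "m \<le> n" for m n
    proof -
      have "(L2.nrm (\<lambda>x. F n x - F m x))\<^sup>2 < e\<^sup>2"
        using step[OF that(2)] N[of m n] that by simp
      then show ?thesis using e by (intro power_less_imp_less_base[OF _ less_imp_le[OF e]])
    qed
    have "L2.nrm (\<lambda>x. F m x - F n x) < e" if "m \<ge> N" "n \<ge> N" for m n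
    proof (cases "m \<le> n")
      case True
      then show ?thesis
        using ordered[OF that(1) True] L2.nrm_minus_commute[OF F_L2 F_L2, of n m] by simp
    next
      case False
      then show ?thesis using ordered[OF that(2), of m] by simp
    qed
    then show "\<exists>N. \<forall>m\<ge>N. \<forall>n\<ge>N. L2.nrm (\<lambda>x. F m x - F n x) < e" by blast
  qed
  moreover have H_lim: "(\<lambda>n. H.nrm (\<lambda>x. F n x - (\<lambda>_. 0) x)) \<longlonglongrightarrow> 0"
  proof (rule Lim_null_comparison[OF always_eventually])
    have "(\<lambda>n. sqrt (inverse (b n))) \<longlonglongrightarrow> sqrt 0"
      unfolding b_def by (intro tendsto_real_sqrt LIMSEQ_inverse_real_of_nat)
    then have "(\<lambda>n. L2.nrm \<psi> * sqrt (inverse (b n))) \<longlonglongrightarrow> L2.nrm \<psi> * sqrt 0"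
      by (intro tendsto_mult tendsto_const)
    then show "(\<lambda>n. L2.nrm \<psi> / sqrt (b n)) \<longlonglongrightarrow> 0"
      by (simp add: real_sqrt_inverse divide_inverse)
    show "\<forall>n. norm (H.nrm (\<lambda>x. F n x - (\<lambda>_. 0) x)) \<le> L2.nrm \<psi> / sqrt (b n)"
      using weak_solution_bound[OF b \<psi> F] H.nrm_nonneg[OF F_H] by simp
  qed
  ultimately have "(\<lambda>n. L2_norm M (\<lambda>x. F n x - 0)) \<longlonglongrightarrow> 0"
    by (intro L2_Cauchy_pointwise(2)[OF F_L2] norm_tendsto_imp_pointwise[OF F_H H.zero_mem H_lim])
  then have lim: "(\<lambda>n. L2.nrm (F n)) \<longlonglongrightarrow> 0" by (simp add: L2_norm_eq)
  show ?thesis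
  proof (rule that)
    show "(\<lambda>x. \<psi> x - F n x) \<in> Domain (adjoint_op M K T)" for n
      by (rule residual_mem_Domain_adjoint[OF b \<psi> F])
    have "L2.nrm (\<lambda>x. \<psi> x - F n x - \<psi> x) = L2.nrm (F n)" for n
      using L2.nrm_scale[OF F_L2, of "-1" n] by simp
    then show "(\<lambda>n. L2.nrm (\<lambda>x. \<psi> x - F n x - \<psi> x)) \<longlonglongrightarrow> 0" using lim by simp
  qed
qed

text \<open>
  By the bound, weak solutions converge in \<open>H(K)\<close> whenever their data converge in \<open>L\<^sup>2\<close>, so the closure has
  at most the value \<open>F\<close> at \<open>\<psi>\<close>; it has a value there because the domain of \<open>T\<^sup>*\<close> is dense.
\<close>

theorem closure_regularized_inverse:
  assumes \<beta>: "0 < \<beta>" and \<psi>: "\<psi> \<in> L2 M" and F: "weak_solution \<beta> \<psi> F"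
  shows "op_closure' M K (regularized_inverse M K T \<beta>) `` {\<psi>} = {F}"
proof -
  have F_H: "F \<in> \<H>" using F closure_dom_rkhs by (simp add: weak_solution_def)
  have conv: "(\<lambda>n. H.nrm (\<lambda>x. t n x - F x)) \<longlonglongrightarrow> 0"
    if s: "\<And>n. s n \<in> L2 M" and t: "\<And>n. weak_solution \<beta> (s n) (t n)"
      and lim: "(\<lambda>n. L2.nrm (\<lambda>x. s n x - \<psi> x)) \<longlonglongrightarrow> 0" for s t
  proof (rule Lim_null_comparison[OF always_eventually])
    show "(\<lambda>n. L2.nrm (\<lambda>x. s n x - \<psi> x) / sqrt \<beta>) \<longlonglongrightarrow> 0"
      using tendsto_divide_zero[OF lim] .
    have t_H: "t n \<in> \<H>" for n using t[of n] closure_dom_rkhs by (simp add: weak_solution_def)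
    have "H.nrm (\<lambda>x. t n x - F x) \<le> L2.nrm (\<lambda>x. s n x - \<psi> x) / sqrt \<beta>" for n
      by (rule weak_solution_bound[OF \<beta> L2.diff_mem[OF s \<psi>] weak_solution_diff[OF \<beta> s \<psi> t F]])
    then show "\<forall>n. norm (H.nrm (\<lambda>x. t n x - F x)) \<le> L2.nrm (\<lambda>x. s n x - \<psi> x) / sqrt \<beta>"
      using H.nrm_nonneg[OF H.diff_mem[OF t_H F_H]] by simp
  qed
  have dom_L2: "s \<in> L2 M" if "s \<in> Domain (adjoint_op M K T)" for s
    using that adjoint_op_iff by blast
  have "(\<psi>, F) \<in> op_closure' M K (regularized_inverse M K T \<beta>)"
  proof -
    obtain s where s: "\<And>n. s n \<in> Domain (adjoint_op M K T)"
      and lim: "(\<lambda>n. L2.nrm (\<lambda>x. s n x - \<psi> x)) \<longlonglongrightarrow> 0"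
      using Domain_adjoint_dense[OF \<psi>] by blast
    have "\<forall>n. \<exists>f. weak_solution \<beta> (s n) f" using weak_solution_exists[OF \<beta> dom_L2[OF s]] by blast
    then obtain t where t: "\<And>n. weak_solution \<beta> (s n) (t n)" by metis
    have "(s n, t n) \<in> regularized_inverse M K T \<beta>" for n
      unfolding regularized_inverse_iff using s t by blast
    then show ?thesis
      unfolding op_closure'_def graph_closure_def rkhs_norm_eq L2_norm_eq
      using \<psi> F_H lim conv[OF dom_L2[OF s] t lim] by blast
  qed
  moreover have "G = F" if "(\<psi>, G) \<in> op_closure' M K (regularized_inverse M K T \<beta>)" for G
  proof -
    have G: "G \<in> \<H>" and "\<exists>s t. (\<forall>n. (s n, t n) \<in> regularized_inverse M K T \<beta>)
        \<and> (\<lambda>n. L2.nrm (\<lambda>x. s n x - \<psi> x)) \<longlonglongrightarrow> 0 \<and> (\<lambda>n. H.nrm (\<lambda>x. t n x - G x)) \<longlonglongrightarrow> 0"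
      using that unfolding op_closure'_def graph_closure_def rkhs_norm_eq L2_norm_eq
      by simp_all
    then obtain s t where st: "\<forall>n. (s n, t n) \<in> regularized_inverse M K T \<beta>"
      and s_lim: "(\<lambda>n. L2.nrm (\<lambda>x. s n x - \<psi> x)) \<longlonglongrightarrow> 0"
      and t_lim: "(\<lambda>n. H.nrm (\<lambda>x. t n x - G x)) \<longlonglongrightarrow> 0"
      by (elim exE conjE)
    have s: "s n \<in> L2 M" and t: "weak_solution \<beta> (s n) (t n)" for n
      using st[rule_format, of n] dom_L2 unfolding regularized_inverse_iff by auto
    have t_H: "t n \<in> \<H>" for n using t[of n] closure_dom_rkhs by (simp add: weak_solution_def)
    have "H.nrm (\<lambda>x. G x - F x) = 0"
      by (rule H.nrm_limit_unique[OF t_H G F_H t_lim conv[OF s t s_lim]])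
    then show ?thesis by (rule eq_if_dist_zero[OF G F_H])
  qed
  ultimately show ?thesis by blast
qed

section \<open>The Tikhonov functional\<close>

text \<open>
  Completing the square: the weak equation turns the cross term \<open>2 Re \<langle>f, \<psi>\<rangle>\<close> into \<open>2 Re \<langle>f, F\<rangle>\<^sub>\<beta>\<close>. The chosen
  value of the closure at \<open>f\<close> is only almost everywhere equal to \<open>f\<close>, which the norm does not see.
\<close>

lemma tikhonov_eq:
  assumes \<beta>: "0 < \<beta>" and \<psi>: "\<psi> \<in> L2 M" and F: "weak_solution \<beta> \<psi> F" and f: "f \<in> closure_dom"
  shows "tikhonov M K (op_closure M K T) \<psi> \<beta> f
    = ereal ((L2.nrm \<psi>)\<^sup>2 - Re (L2_inner M F \<psi>)
        + (form_norm (graph_inner \<beta>) (\<lambda>x. f x - F x))\<^sup>2)"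
proof -
  interpret G: psd_form closure_dom "graph_inner \<beta>"
    using psd_form_graph_inner[OF less_imp_le[OF \<beta>]] .
  have F_cd: "F \<in> closure_dom" using F by (simp add: weak_solution_def)
  note f_L2 = closure_dom_L2[OF f]
  define g where "g = op_apply (op_closure M K T) f"
  have ff: "(f, f) \<in> op_closure M K T" using f f_L2 by (simp add: op_closure_iff)
  then have "(f, g) \<in> op_closure M K T"
    unfolding g_def op_apply_def by (rule someI[of "\<lambda>g. (f, g) \<in> op_closure M K T"])
  then have g: "g \<in> L2 M" and ae: "AE x in M. g x = f x" by (simp_all add: op_closure_iff)
  have "AE x in M. \<psi> x - g x = \<psi> x - f x" using ae by eventually_elim simp
  then have "L2_norm M (\<lambda>x. \<psi> x - g x) = L2_norm M (\<lambda>x. \<psi> x - f x)"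
    by (rule L2_norm_cong_AE[OF L2.diff_mem[OF \<psi> g] L2.diff_mem[OF \<psi> f_L2]])
  then have "tikhonov M K (op_closure M K T) \<psi> \<beta> f
      = ereal ((L2.nrm (\<lambda>x. \<psi> x - f x))\<^sup>2 + \<beta> * (H.nrm f)\<^sup>2)"
    using ff unfolding tikhonov_def g_def[symmetric] rkhs_norm_eq by (auto simp: L2_norm_eq)
  moreover have "(L2.nrm (\<lambda>x. \<psi> x - f x))\<^sup>2
      = (L2.nrm \<psi>)\<^sup>2 - 2 * Re (L2_inner M f \<psi>) + (L2.nrm f)\<^sup>2"
    using L2.nrm_diff_power2[OF \<psi> f_L2] L2.herm[OF \<psi> f_L2] by simp
  moreover have "(G.nrm f)\<^sup>2 = (L2.nrm f)\<^sup>2 + \<beta> * (H.nrm f)\<^sup>2"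
    by (rule graph_norm_power2[OF less_imp_le[OF \<beta>] f])
  moreover have "(G.nrm (\<lambda>x. f x - F x))\<^sup>2
      = (G.nrm f)\<^sup>2 - 2 * Re (L2_inner M f \<psi>) + Re (L2_inner M F \<psi>)"
    using F f F_cd by (simp add: G.nrm_diff_power2 G.nrm_power2 weak_solution_def)
  ultimately show ?thesis by simp
qed

lemma tikhonov_outside:
  "f \<notin> closure_dom \<Longrightarrow> tikhonov M K (op_closure M K T) \<psi> \<beta> f = \<infinity>"
  by (auto simp: tikhonov_def op_closure_iff)

lemma tikhonov_weak_solution:
  assumes \<beta>: "0 < \<beta>" and \<psi>: "\<psi> \<in> L2 M" and F: "weak_solution \<beta> \<psi> F"
  shows "tikhonov M K (op_closure M K T) \<psi> \<beta> F
    = ereal ((L2.nrm \<psi>)\<^sup>2 - Re (L2_inner M F \<psi>))"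
proof -
  interpret G: psd_form closure_dom "graph_inner \<beta>"
    using psd_form_graph_inner[OF less_imp_le[OF \<beta>]] .
  have "F \<in> closure_dom" using F by (simp add: weak_solution_def)
  from tikhonov_eq[OF \<beta> \<psi> F this] show ?thesis using G.nrm_zero by simp
qed

lemma tikhonov_ge:
  assumes \<beta>: "0 < \<beta>" and \<psi>: "\<psi> \<in> L2 M" and F: "weak_solution \<beta> \<psi> F"
  shows "tikhonov M K (op_closure M K T) \<psi> \<beta> F \<le> tikhonov M K (op_closure M K T) \<psi> \<beta> f"
proof (cases "f \<in> closure_dom")
  case True
  then show ?thesis
    unfolding tikhonov_weak_solution[OF assms] tikhonov_eq[OF assms True] by simp
next
  case False
  then show ?thesis by (simp add: tikhonov_outside)
qed

theorem tikhonov_unique_minimizer: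
  assumes \<beta>: "0 < \<beta>" and \<psi>: "\<psi> \<in> L2 M" and F: "weak_solution \<beta> \<psi> F"
  shows "is_arg_min (tikhonov M K (op_closure M K T) \<psi> \<beta>) (\<lambda>f. f \<in> \<H>) G \<longleftrightarrow> G = F"
proof
  interpret G: psd_form closure_dom "graph_inner \<beta>"
    using psd_form_graph_inner[OF less_imp_le[OF \<beta>]] .
  have F_cd: "F \<in> closure_dom" using F by (simp add: weak_solution_def)
  note F_H = closure_dom_rkhs[OF F_cd]
  show "is_arg_min (tikhonov M K (op_closure M K T) \<psi> \<beta>) (\<lambda>f. f \<in> \<H>) G" if "G = F"
    unfolding that is_arg_min_def using F_H tikhonov_ge[OF assms] by (simp add: not_less)
  assume "is_arg_min (tikhonov M K (op_closure M K T) \<psi> \<beta>) (\<lambda>f. f \<in> \<H>) G"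
  then have G: "G \<in> \<H>" and le: "tikhonov M K (op_closure M K T) \<psi> \<beta> G
      \<le> tikhonov M K (op_closure M K T) \<psi> \<beta> F"
    using F_H unfolding is_arg_min_def by (auto simp: not_less)
  have G_cd: "G \<in> closure_dom"
    using le tikhonov_outside[of G] unfolding tikhonov_weak_solution[OF assms] by force
  note d = G.diff_mem[OF G_cd F_cd]
  have "(G.nrm (\<lambda>x. G x - F x))\<^sup>2 \<le> 0"
    using le unfolding tikhonov_weak_solution[OF assms] tikhonov_eq[OF assms G_cd] by simp
  then have "H.nrm (\<lambda>x. G x - F x) \<le> 0"
    using rkhs_norm_le_graph_norm[OF \<beta> d] by simp
  then have "H.nrm (\<lambda>x. G x - F x) = 0" using H.nrm_nonneg[OF closure_dom_rkhs[OF d]] by simp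
  then show "G = F" by (rule eq_if_dist_zero[OF G F_H])
qed

theorem tikhonov_infimum:
  assumes \<beta>: "0 < \<beta>" and \<psi>: "\<psi> \<in> L2 M" and F: "weak_solution \<beta> \<psi> F"
  shows "tikhonov M K (op_closure M K T) \<psi> \<beta> F
    = (INF f\<in>D. tikhonov M K (op_closure M K T) \<psi> \<beta> f)"
proof (rule antisym)
  interpret G: psd_form closure_dom "graph_inner \<beta>"
    using psd_form_graph_inner[OF less_imp_le[OF \<beta>]] .
  let ?Q = "tikhonov M K (op_closure M K T) \<psi> \<beta>"
  have F_cd: "F \<in> closure_dom" using F by (simp add: weak_solution_def)
  show "?Q F \<le> (INF f\<in>D. ?Q f)" by (rule INF_greatest) (rule tikhonov_ge[OF assms])
  obtain d where d: "\<And>n. d n \<in> D" "(\<lambda>n. H.nrm (\<lambda>x. d n x - F x)) \<longlonglongrightarrow> 0"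
    "(\<lambda>n. L2.nrm (\<lambda>x. d n x - F x)) \<longlonglongrightarrow> 0" using closure_dom_sequence[OF F_cd] by blast
  have d_cd: "d n \<in> closure_dom" for n using d(1) D_subset_closure_dom by blast
  have "(\<lambda>n. G.nrm (\<lambda>x. d n x - F x)) \<longlonglongrightarrow> 0"
    by (rule graph_norm_tendsto_zero[OF less_imp_le[OF \<beta>] G.diff_mem[OF d_cd F_cd] d(2,3)])
  then have "(\<lambda>n. (L2.nrm \<psi>)\<^sup>2 - Re (L2_inner M F \<psi>) + (G.nrm (\<lambda>x. d n x - F x))\<^sup>2)
      \<longlonglongrightarrow> (L2.nrm \<psi>)\<^sup>2 - Re (L2_inner M F \<psi>) + 0\<^sup>2"
    by (intro tendsto_intros)
  then have "(\<lambda>n. ?Q (d n)) \<longlonglongrightarrow> ?Q F"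
    unfolding tikhonov_weak_solution[OF assms] tikhonov_eq[OF assms d_cd] by simp
  then show "(INF f\<in>D. ?Q f) \<le> ?Q F"
    by (rule LIMSEQ_le_const) (use d(1) in \<open>auto intro: INF_lower\<close>)
qed

end

theorem theorem2p5:
  fixes M :: "'a measure" and K :: "'a \<Rightarrow> 'a \<Rightarrow> complex"
    and D :: "('a \<Rightarrow> complex) set" and T :: "(('a \<Rightarrow> complex) \<times> ('a \<Rightarrow> complex)) set"
    and \<beta> :: real and \<psi> :: "'a \<Rightarrow> complex"
  assumes "sigma_finite_measure M"
    and "pos_def_kernel (space M) K"
    and "fun_subspace D" and "D \<subseteq> rkhs (space M) K" and "D \<subseteq> L2 M"
    and "T = eval_op M D"
    and "rkhs_dense (space M) K (Domain T)"
    and "closable_op M K T"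
    and "\<beta> > 0" and "\<psi> \<in> L2 M"
  shows "(\<forall>h \<in> rkhs (space M) K. \<exists>!f. (f, h) \<in> shift_op \<beta> (normal_op M K T)) \<and>
    (\<exists>F \<in> rkhs (space M) K.
       (\<forall>G. is_arg_min (tikhonov M K (op_closure M K T) \<psi> \<beta>) (\<lambda>f. f \<in> rkhs (space M) K) G
             \<longleftrightarrow> G = F) \<and>
       tikhonov M K (op_closure M K T) \<psi> \<beta> F
         = (INF f\<in>Domain T. tikhonov M K (op_closure M K T) \<psi> \<beta> f) \<and>
       (\<psi> \<in> Domain (adjoint_op M K T) \<longrightarrow> regularized_inverse M K T \<beta> `` {\<psi>} = {F}) \<and>
       op_closure' M K (regularized_inverse M K T \<beta>) `` {\<psi>} = {F})"
proof -
  interpret E: evaluation_operator M K D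
    using assms(2-5) by unfold_locales
  note \<beta> = assms(9) and \<psi> = assms(10) and T = assms(6)
  obtain F where F: "E.weak_solution \<beta> \<psi> F"
    using E.weak_solution_exists[OF \<beta> \<psi>] by blast
  have F_H: "F \<in> rkhs (space M) K"
    using F E.closure_dom_rkhs by (simp add: E.weak_solution_def)
  have "regularized_inverse M K T \<beta> `` {\<psi>} = {F}" if "\<psi> \<in> Domain (adjoint_op M K T)"
  proof -
    have "(\<psi>, f) \<in> regularized_inverse M K T \<beta> \<longleftrightarrow> f = F" for f
      unfolding T E.regularized_inverse_iff
      using that[unfolded T] F E.weak_solution_unique[OF \<beta> _ F] by blast
    then show ?thesis by blast
  qed
  moreover have "\<forall>h \<in> rkhs (space M) K. \<exists>!f. (f, h) \<in> shift_op \<beta> (normal_op M K T)"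
    unfolding T using E.shift_normal_op_bijective[OF \<beta>] by blast
  ultimately show ?thesis
    using F_H E.tikhonov_unique_minimizer[OF \<beta> \<psi> F] E.tikhonov_infimum[OF \<beta> \<psi> F]
      E.closure_regularized_inverse[OF \<beta> \<psi> F]
    unfolding T E.Domain_T by blast
qed

end
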